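(* Consider, in the phase space $\mathcal C=C_g^0(\mathbb R^n)$, the system $$x_i'(t)=-\sum_{j=1}^n d_{ij}(t)x_j(t)+\sum_{j=1}^n a_{ij}(t)\int_{-\tau_{ij}(t)}^0 x_j(t+s)\,d_s\nu_{ij}(t,s),\qquad i=1,\dots,n,\ t\ge0,\qquad( * )$$ with $\tau_{ij}:[0,\infty)\to[0,\infty)$ continuous (possibly unbounded), set $\tau(t)=\max_{1\le i,j\le n}\tau_{ij}(t)$, and suppose $\tau(t)\le t$ for $t$ large. Assume that the functions $d_{ij}:[0,\infty)\to\mathbb R$ and the maps $L_{ij}:[0,\infty)\to L(C_g^0(\mathbb R),\mathbb R)$, $L_{ij}(t)\psi=a_{ij}(t)\int_{-\tau_{ij}(t)}^0\psi(s)\,d_s\nu_{ij}(t,s)$, are continuous, where the bounded variation functions $\nu_{ij}(t,\cdot):[-\tau_{ij}(t),0]\to\mathbb R$ satisfy $\int_{-\tau_{ij}(t)}^0 g(s)\,d_s|\nu_{ij}|(t,s)=1$ for $t\ge0$, $i,j=1,\dots,n$. Assume also that there exist a vector $v>0$ in $\mathbb R^n$, $\alpha>1$ and $T\ge0$ such that $$\widehat D(t)v\ge\alpha A(t)v\qquad\text{for } t\ge T,$$ and that, for such $v$ and $T$, there exists a measurable, locally integrable function $e:\mathbb R\to[0,\infty)$ such that: (i) $\min_{1\le i\le n}(M(t)v)_i\ge e(t)$ for $t\ge T$; (ii) $\int_0^\infty e(t)\,dt=\infty$; (iii) $\sup_{t\ge T}\int_{t-\tau(t)}^t e(u)\,du<\infty$.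 Then $( * )$ is asymptotically stable.
   Context: Phase space: $g:(-\infty,0]\to[1,\infty)$ is a fixed nonincreasing continuous function with $g(0)=1$, $\lim_{s\to-\infty}g(s)=\infty$ and $\lim_{u\to0^-}g(s+u)/g(s)=1$ uniformly for $s\in(-\infty,0]$. For $m\in\mathbb N$, $C_g^0(\mathbb R^m)$ is the Banach space of continuous $\phi:(-\infty,0]\to\mathbb R^m$ with $\lim_{s\to-\infty}|\phi(s)|/g(s)=0$, with norm $\|\phi\|=\|\phi\|_g=\sup_{s\le0}|\phi(s)|/g(s)$, where $|x|=\max_i|x_i|$. $L(C_g^0(\mathbb R),\mathbb R)$ is the dual of $C_g^0(\mathbb R)$ with the operator norm. $x_t(s)=x(t+s)$ for $s\le0$. $|\nu_{ij}|(t,\cdot)$ is the total variation measure of $d_s\nu_{ij}(t,s)$; the normalization gives $a_{ij}(t)=\|L_{ij}(t)\|\ge0$. $\widehat D(t)=[\hat d_{ij}(t)]$ with $\hat d_{ii}(t)=d_{ii}(t)$, $\hat d_{ij}(t)=-|d_{ij}(t)|$ for $i\ne j$; $A(t)=[a_{ij}(t)]$; $M(t)=\widehat D(t)-A(t)$. Vector inequalities are componentwise; $v>0$ means all components are positive. For $\sigma\ge0$, $\phi\in\mathcal C$, $x(t,\sigma,\phi)$, $t\ge\sigma$, is the solution with $x_\sigma=\phi$, and $x_t(\sigma,\phi)$ its history in $\mathcal C$. The system is stable on $[\alpha,\infty)$ if for every $\varepsilon>0$ and $\sigma\ge\alpha$ there is $\delta=\delta(\varepsilon,\sigma)>0$ such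 that $\|\phi\|<\delta$ implies $\|x_t(\sigma,\phi)\|<\varepsilon$ for all $t\ge\sigma$. It is asymptotically stable if it is stable on some interval $[\alpha,\infty)\subset[0,\infty)$ and $\lim_{t\to\infty}x(t,\sigma,\phi)=0$ for all $\sigma\ge0$, $\phi\in\mathcal C$. *)

theory Defs
  imports "HOL-Analysis.Analysis"
begin

text \<open>
  A function on the half-line \<open>(-\<infinity>, 0]\<close> is a total function on the reals of which only the
  restriction to \<open>{..0}\<close> is ever used.  The weight \<open>g\<close> is a parameter, so the phase space and its
  dual are carrier sets with explicit norms rather than types.
\<close>

definition phase_weight :: "(real \<Rightarrow> real) \<Rightarrow> bool" where
  "phase_weight g \<longleftrightarrow>
     (\<forall>s\<le>0. 1 \<le> g s) \<and> antimono_on {..0} g \<and> continuous_on {..0} g \<and> g 0 = 1 \<and>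
     filterlim g at_top at_bot \<and>
     uniform_limit {..0} (\<lambda>u s. g (s + u) / g s) (\<lambda>_. 1) (at_left 0)"

text \<open>
  The norm of a vector is the maximum norm, which is \<^const>\<open>infnorm\<close>; on the reals it is the
  absolute value, so the case \<open>'a = real\<close> is the scalar phase space.
\<close>

definition Cg0 :: "(real \<Rightarrow> real) \<Rightarrow> (real \<Rightarrow> 'a::euclidean_space) set" where
  "Cg0 g = {\<phi>. continuous_on {..0} \<phi> \<and> ((\<lambda>s. infnorm (\<phi> s) / g s) \<longlongrightarrow> 0) at_bot}"

definition Cg0_norm :: "(real \<Rightarrow> real) \<Rightarrow> (real \<Rightarrow> 'a::euclidean_space) \<Rightarrow> real" where
  "Cg0_norm g \<phi> = (SUP s\<in>{..0}. infnorm (\<phi> s) / g s)"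

definition Cg0_dual :: "(real \<Rightarrow> real) \<Rightarrow> ((real \<Rightarrow> real) \<Rightarrow> real) set" where
  "Cg0_dual g = {L.
     (\<forall>\<phi>\<in>Cg0 g. \<forall>\<psi>\<in>Cg0 g. L (\<lambda>s. \<phi> s + \<psi> s) = L \<phi> + L \<psi>) \<and>
     (\<forall>c. \<forall>\<phi>\<in>Cg0 g. L (\<lambda>s. c * \<phi> s) = c * L \<phi>) \<and>
     (\<exists>K. \<forall>\<phi>\<in>Cg0 g. \<bar>L \<phi>\<bar> \<le> K * Cg0_norm g \<phi>)}"

definition dual_norm :: "(real \<Rightarrow> real) \<Rightarrow> ((real \<Rightarrow> real) \<Rightarrow> real) \<Rightarrow> real" where
  "dual_norm g L = (SUP \<phi>\<in>{\<phi> \<in> Cg0 g. Cg0_norm g \<phi> \<le> 1}. \<bar>L \<phi>\<bar>)"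

definition dual_continuous_on ::
    "(real \<Rightarrow> real) \<Rightarrow> real set \<Rightarrow> (real \<Rightarrow> (real \<Rightarrow> real) \<Rightarrow> real) \<Rightarrow> bool" where
  "dual_continuous_on g S L \<longleftrightarrow>
     (\<forall>t\<in>S. ((\<lambda>u. dual_norm g (\<lambda>\<psi>. L u \<psi> - L t \<psi>)) \<longlongrightarrow> 0) (at t within S))"


definition variation_sums :: "(real \<Rightarrow> real) \<Rightarrow> real \<Rightarrow> real \<Rightarrow> real set" where
  "variation_sums f a b =
     {(\<Sum>k<m. \<bar>f (p (Suc k)) - f (p k)\<bar>) | (m::nat) (p::nat \<Rightarrow> real). mono p \<and> p 0 = a \<and> p m = b}"

definition bounded_variation :: "(real \<Rightarrow> real) \<Rightarrow> real \<Rightarrow> real \<Rightarrow> bool" where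
  "bounded_variation f a b \<longleftrightarrow> bdd_above (variation_sums f a b)"

definition variation :: "(real \<Rightarrow> real) \<Rightarrow> real \<Rightarrow> real \<Rightarrow> real" where
  "variation f a b = Sup (variation_sums f a b)"

text \<open>
  The Lebesgue--Stieltjes measure of a nondecreasing \<open>F\<close> on \<open>[a, b]\<close>.  As
  \<^const>\<open>interval_measure\<close> needs a right-continuous distribution function on the whole line, \<open>F\<close> is
  replaced by its right limits on \<open>[a, b)\<close> and extended by constants.  Both end points may carry
  an atom, of mass \<open>F(a+) - F(a)\<close> at \<open>a\<close> and \<open>F(b) - F(b-)\<close> at \<open>b\<close>; nothing lies outside \<open>[a, b]\<close>.
\<close>

definition mono_stieltjes_measure :: "(real \<Rightarrow> real) \<Rightarrow> real \<Rightarrow> real \<Rightarrow> real measure" where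
  "mono_stieltjes_measure F a b =
     interval_measure (\<lambda>x. if x < a then F a else if x < b then (INF y\<in>{x<..b}. F y) else F b)"

text \<open>
  For \<open>f\<close> of bounded variation on \<open>[a, b]\<close>, the signed measure \<open>df\<close> and the integral against it
  come from the decomposition \<open>f = V - (V - f)\<close> into nondecreasing functions, where \<open>V x\<close> is the
  variation of \<open>f\<close> on \<open>[a, x]\<close>.
\<close>

definition stieltjes_signed_measure :: "(real \<Rightarrow> real) \<Rightarrow> real \<Rightarrow> real \<Rightarrow> real set \<Rightarrow> real" where
  "stieltjes_signed_measure f a b E =
     measure (mono_stieltjes_measure (variation f a) a b) E -
     measure (mono_stieltjes_measure (\<lambda>x. variation f a x - f x) a b) E"

definition stieltjes_integral :: "(real \<Rightarrow> real) \<Rightarrow> real \<Rightarrow> real \<Rightarrow> (real \<Rightarrow> real) \<Rightarrow> real" where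
  "stieltjes_integral f a b \<psi> =
     (LINT s:{a..b}|mono_stieltjes_measure (variation f a) a b. \<psi> s) -
     (LINT s:{a..b}|mono_stieltjes_measure (\<lambda>x. variation f a x - f x) a b. \<psi> s)"

definition total_variation_measure :: "(real set \<Rightarrow> real) \<Rightarrow> real measure" where
  "total_variation_measure \<mu> =
     measure_of UNIV (sets borel)
       (\<lambda>E. SUP P\<in>{P. finite P \<and> P \<subseteq> sets borel \<and> disjoint P \<and> \<Union>P = E}.
              \<Sum>B\<in>P. ennreal \<bar>\<mu> B\<bar>)"


definition history :: "(real \<Rightarrow> 'a) \<Rightarrow> real \<Rightarrow> real \<Rightarrow> 'a" where
  "history x t = (\<lambda>s. x (t + s))"

definition delay_functional ::
    "(real \<Rightarrow> real^'n^'n) \<Rightarrow> ('n \<Rightarrow> 'n \<Rightarrow> real \<Rightarrow> real) \<Rightarrow> ('n \<Rightarrow> 'n \<Rightarrow> real \<Rightarrow> real \<Rightarrow> real) \<Rightarrow>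
     'n \<Rightarrow> 'n \<Rightarrow> real \<Rightarrow> (real \<Rightarrow> real) \<Rightarrow> real" where
  "delay_functional A \<tau> \<nu> i j t \<psi> = A t $ i $ j * stieltjes_integral (\<nu> i j t) (- \<tau> i j t) 0 \<psi>"

definition max_delay :: "('n::finite \<Rightarrow> 'n \<Rightarrow> real \<Rightarrow> real) \<Rightarrow> real \<Rightarrow> real" where
  "max_delay \<tau> t = Max {\<tau> i j t | i j. True}"

definition is_solution ::
    "(real \<Rightarrow> real^'n^'n) \<Rightarrow> (real \<Rightarrow> real^'n^'n) \<Rightarrow> ('n \<Rightarrow> 'n \<Rightarrow> real \<Rightarrow> real) \<Rightarrow>
     ('n \<Rightarrow> 'n \<Rightarrow> real \<Rightarrow> real \<Rightarrow> real) \<Rightarrow> real \<Rightarrow> (real \<Rightarrow> real^'n) \<Rightarrow> (real \<Rightarrow> real^'n) \<Rightarrow> bool" where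
  "is_solution D A \<tau> \<nu> \<sigma> \<phi> x \<longleftrightarrow>
     (\<forall>s\<le>0. history x \<sigma> s = \<phi> s) \<and>
     (\<forall>t\<ge>\<sigma>. \<forall>i. ((\<lambda>u. x u $ i) has_real_derivative
          (- (\<Sum>j\<in>UNIV. D t $ i $ j * x t $ j)
           + (\<Sum>j\<in>UNIV. delay_functional A \<tau> \<nu> i j t (\<lambda>s. history x t s $ j))))
        (at t within {\<sigma>..}))"

text \<open>
  The two clauses above prescribe \<open>x\<close> on the whole line, so the solution is unique as a total
  function and the definite description denotes it.
\<close>

definition solution ::
    "(real \<Rightarrow> real^'n^'n) \<Rightarrow> (real \<Rightarrow> real^'n^'n) \<Rightarrow> ('n \<Rightarrow> 'n \<Rightarrow> real \<Rightarrow> real) \<Rightarrow>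
     ('n \<Rightarrow> 'n \<Rightarrow> real \<Rightarrow> real \<Rightarrow> real) \<Rightarrow> real \<Rightarrow> (real \<Rightarrow> real^'n) \<Rightarrow> real \<Rightarrow> real^'n" where
  "solution D A \<tau> \<nu> \<sigma> \<phi> = (THE x. is_solution D A \<tau> \<nu> \<sigma> \<phi> x)"

text \<open>In the next two definitions \<open>X \<sigma> \<phi>\<close> is the solution with initial time \<open>\<sigma>\<close> and history \<open>\<phi>\<close>.\<close>

definition stable_from ::
    "(real \<Rightarrow> real) \<Rightarrow> (real \<Rightarrow> (real \<Rightarrow> 'a::euclidean_space) \<Rightarrow> real \<Rightarrow> 'a) \<Rightarrow> real \<Rightarrow> bool" where
  "stable_from g X \<alpha> \<longleftrightarrow>
     (\<forall>\<epsilon>>0. \<forall>\<sigma>\<ge>\<alpha>. \<exists>\<delta>>0. \<forall>\<phi>\<in>Cg0 g. Cg0_norm g \<phi> < \<delta> \<longrightarrow>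
        (\<forall>t\<ge>\<sigma>. Cg0_norm g (history (X \<sigma> \<phi>) t) < \<epsilon>))"

definition asymptotically_stable ::
    "(real \<Rightarrow> real) \<Rightarrow> (real \<Rightarrow> (real \<Rightarrow> 'a::euclidean_space) \<Rightarrow> real \<Rightarrow> 'a) \<Rightarrow> bool" where
  "asymptotically_stable g X \<longleftrightarrow>
     (\<exists>\<alpha>\<ge>0. stable_from g X \<alpha>) \<and>
     (\<forall>\<sigma>\<ge>0. \<forall>\<phi>\<in>Cg0 g. (X \<sigma> \<phi> \<longlongrightarrow> 0) at_top)"


definition D_hat :: "real^'n^'n \<Rightarrow> real^'n^'n" where
  "D_hat D = (\<chi> i j. if i = j then D $ i $ i else - \<bar>D $ i $ j\<bar>)"

end

theory Submission
  imports Defs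
begin

text \<open>
  Scale each component by \<open>v\<^sub>i\<close>.  From some time \<open>T0\<close> on the delay interval \<open>[t - \<tau> t, t]\<close> lies in
  \<open>[0, t]\<close>, and since \<open>g \<ge> 1\<close> the normalisation of \<open>\<nu>\<close> makes every delay term at most \<open>a\<^sub>i\<^sub>j\<close> times the
  supremum of \<open>\<bar>x\<^sub>j\<bar>\<close> over that interval (lemma \<open>abs_stieltjes_integral_le\<close>).  The system is thus governed
  by a delay differential inequality of Halanay type, and the claim is that
  \<open>\<bar>x\<^sub>j t\<bar> \<le> v\<^sub>j W exp (- c E t)\<close> with \<open>E t\<close> the integral of \<open>e\<close> over \<open>[0, t]\<close>, for a small constant \<open>c\<close>.

  By (iii) the function \<open>E\<close> varies by at most a constant \<open>B\<close> over a delay interval, so the majorant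
  there exceeds its current value by at most the factor \<open>exp (c B)\<close>, which for small \<open>c\<close> is at most
  some fixed \<open>\<beta>\<close> between 1 and \<open>\<alpha>\<close>.  When a component touches the majorant, the condition
  \<open>D_hat v \<ge> \<alpha> A v\<close> forces it to decrease at
  relative rate at least \<open>(1 - \<beta> / \<alpha>) (D_hat v)\<^sub>i / v\<^sub>i\<close> (lemma \<open>delayed_row_inequality\<close>).  The majorant
  decreases at relative rate \<open>c e\<close>, and (i) together with \<open>A \<ge> 0\<close> gives \<open>e \<le> (D_hat v)\<^sub>i\<close>; for small \<open>c\<close>
  the component cannot cross.  As \<open>e\<close> is only measurable, the two rates are compared through the
  integral of the continuous function \<open>(D_hat v)\<^sub>i\<close> (lemma \<open>delay_comparison\<close>).  Stability follows because
  \<open>W\<close> is proportional to the size of the initial history, and convergence to 0 because \<open>E\<close> is unbounded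
  by (ii).

  Before that the initial value problem has to be solved, since the solution is a definite
  description: histories depend continuously on time in the phase space, so the right-hand side is
  continuous along every continuous continuation of the initial history, and Picard iteration
  contracts in an exponentially weighted norm (theorem \<open>unique_solution\<close>).
\<close>

section \<open>Bounds for Stieltjes integrals\<close>

lemma variation_sums_extend:
  assumes "s \<in> variation_sums f a x" and "x \<le> y"
  shows "s + \<bar>f y - f x\<bar> \<in> variation_sums f a y"
proof -
  obtain m p where mp: "s = (\<Sum>k<m. \<bar>f (p (Suc k)) - f (p k)\<bar>)" "mono p" "p 0 = a" "p m = x"
    using assms(1) unfolding variation_sums_def by blast
  define q where "q = (\<lambda>k. if k \<le> m then p k else y)"
  have "mono q"
  proof (rule monoI)
    fix k l :: nat assume kl: "k \<le> l"
    have "p k \<le> p l" "k \<le> m \<Longrightarrow> p k \<le> p m" using kl mp(2) by (auto simp: mono_def)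
    then show "q k \<le> q l" using kl assms(2) mp(4) by (auto simp: q_def)
  qed
  moreover have "(\<Sum>k<Suc m. \<bar>f (q (Suc k)) - f (q k)\<bar>) = s + \<bar>f y - f x\<bar>"
    by (simp add: q_def mp)
  moreover have "q 0 = a" "q (Suc m) = y" by (simp_all add: q_def mp)
  ultimately show ?thesis unfolding variation_sums_def
    by (intro CollectI exI[of _ "Suc m"] exI[of _ q]) auto
qed

lemma variation_sums_nonempty:
  assumes "a \<le> x"
  shows "variation_sums f a x \<noteq> {}"
proof -
  have "0 \<in> variation_sums f a a" unfolding variation_sums_def
    by (intro CollectI exI[of _ 0] exI[of _ "\<lambda>_. a"]) (auto simp: mono_def)
  from variation_sums_extend[OF this assms] show ?thesis by auto
qed

lemma variation_increment:
  assumes "bounded_variation f a b" and "a \<le> x" "x \<le> y" "y \<le> b"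
  shows "variation f a x + \<bar>f y - f x\<bar> \<le> variation f a y"
proof -
  obtain M where M: "\<And>s. s \<in> variation_sums f a b \<Longrightarrow> s \<le> M"
    using assms(1) unfolding bounded_variation_def bdd_above_def by blast
  have bdd: "bdd_above (variation_sums f a y)"
  proof (rule bdd_aboveI[of _ M])
    fix s assume "s \<in> variation_sums f a y"
    from M[OF variation_sums_extend[OF this assms(4)]] show "s \<le> M" by linarith
  qed
  have "s \<le> variation f a y - \<bar>f y - f x\<bar>" if "s \<in> variation_sums f a x" for s
    using cSup_upper[OF variation_sums_extend[OF that assms(3)] bdd]
    by (simp add: variation_def)
  then have "variation f a x \<le> variation f a y - \<bar>f y - f x\<bar>"
    unfolding variation_def[of f a x] by (intro cSup_least variation_sums_nonempty assms)
  then show ?thesis by simp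
qed

text \<open>
  Replacing \<open>F\<close> by its right limits inside the interval keeps it between its values at the end
  points, so the resulting distribution function is again nondecreasing, and it is right-continuous;
  the mass of \<open>[a, b]\<close> is at most its increment over a slightly longer half-open interval.
\<close>

lemma emeasure_mono_stieltjes_finite:
  assumes F: "mono_on {a..b} F" and ab: "a \<le> b"
  shows "emeasure (mono_stieltjes_measure F a b) {a..b} < \<infinity>"
proof -
  define G where "G = (\<lambda>x. if x < a then F a else if x < b then (INF y\<in>{x<..b}. F y) else F b)"
  have F': "F x \<le> F y" if "a \<le> x" "x \<le> y" "y \<le> b" for x y
    using F that by (auto simp: mono_on_def)
  have bdd: "bdd_below (F ` {x<..b})" if "a \<le> x" for x
    by (rule bdd_belowI2[of _ "F a"]) (use that ab in \<open>auto intro!: F'\<close>)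
  \<comment> \<open>A right limit at \<open>x\<close> lies between \<open>F x\<close> and every later value; monotonicity and right continuity of \<open>G\<close> follow.\<close>
  have low: "F x \<le> G x" and up: "\<And>y. x < y \<Longrightarrow> y \<le> b \<Longrightarrow> G x \<le> F y" if "a \<le> x" "x \<le> b" for x
  proof -
    show "F x \<le> G x" unfolding G_def using that by (auto intro!: cINF_greatest F')
    fix y assume "x < y" "y \<le> b"
    then show "G x \<le> F y" unfolding G_def using that bdd[of x] by (auto intro!: cINF_lower)
  qed
  have mono: "G x \<le> G y" if "x \<le> y" for x y
  proof -
    consider "x < a" "y < a" | "x < a" "a \<le> y" "y \<le> b" | "x < a" "b < y" | "a \<le> x" "x < y" "y \<le> b"
      | "a \<le> x" "x < b" "b < y" | "x = y" | "b \<le> x" using \<open>x \<le> y\<close> ab by linarith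
    then show ?thesis
    proof cases
      case 2
      then have "F a \<le> F y" by (intro F') auto
      with 2 low[of y] ab show ?thesis by (simp add: G_def[THEN fun_cong, of x])
    next
      case 3
      then show ?thesis using F'[of a b] ab by (auto simp: G_def)
    next
      case 4
      then show ?thesis using low[of y] up[of x y] by linarith
    next
      case 5
      then show ?thesis using up[of x b] ab by (simp add: G_def[THEN fun_cong, of y])
    qed (use \<open>x \<le> y\<close> ab in \<open>auto simp: G_def\<close>)
  qed
  have cont: "continuous (at_right x) G" for x
  proof -
    have "(G \<longlongrightarrow> G x) (at_right x)"
    proof (cases "a \<le> x \<and> x < b")
      case False
      then consider "x < a" | "b \<le> x" by linarith
      then have "eventually (\<lambda>y. G y = G x) (at_right x)"
      proof cases
        case 1
        have "eventually (\<lambda>y. y \<in> {x<..<a}) (at_right x)"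
          using 1 by (rule eventually_at_right_real)
        then show ?thesis by eventually_elim (use 1 in \<open>auto simp: G_def\<close>)
      next
        case 2
        have "eventually (\<lambda>y. y \<in> {x<..<x+1}) (at_right x)"
          by (rule eventually_at_right_real) simp
        then show ?thesis by eventually_elim (use 2 ab in \<open>auto simp: G_def\<close>)
      qed
      then show ?thesis by (rule tendsto_eventually)
    next
      case True
      show ?thesis
      proof (rule order_tendstoI)
        fix c assume "c < G x"
        then show "eventually (\<lambda>y. c < G y) (at_right x)"
          using mono[of x] by (intro eventually_at_rightI[of x "x+1"]) (auto intro: less_le_trans)
      next
        fix c assume "G x < c"
        then have "(INF y\<in>{x<..b}. F y) < c" using True by (simp add: G_def)
        then obtain y where y: "x < y" "y \<le> b" "F y < c"
          using True cINF_less_iff[OF _ bdd[of x], of c] by auto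
        show "eventually (\<lambda>z. G z < c) (at_right x)"
        proof (rule eventually_at_rightI[of x y])
          fix z assume "z \<in> {x<..<y}"
          then have "G z \<le> F y" using True y by (intro up) auto
          then show "G z < c" using y by simp
        qed (use y in auto)
      qed
    qed
    then show ?thesis by (simp add: continuous_within)
  qed
  have "emeasure (interval_measure G) {a..b} \<le> emeasure (interval_measure G) {a-1<..b}"
    by (rule emeasure_mono) auto
  also have "\<dots> = ennreal (G b - G (a-1))"
    using ab by (intro emeasure_interval_measure_Ioc mono cont) auto
  also have "\<dots> < \<infinity>" by simp
  finally show ?thesis by (simp add: mono_stieltjes_measure_def G_def)
qed

text \<open>
  The inequality between measures of sets is inherited by simple functions and passes to monotone
  limits.
\<close>

lemma nn_integral_le_add:
  assumes [measurable_cong]: "sets M1 = sets M" "sets M2 = sets M" "sets M3 = sets M"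
    and le: "\<And>B. B \<in> sets M \<Longrightarrow> emeasure M1 B \<le> emeasure M2 B + emeasure M3 B"
    and f: "f \<in> borel_measurable M"
  shows "integral\<^sup>N M1 f \<le> integral\<^sup>N M2 f + integral\<^sup>N M3 f"
  using f
proof (induction f rule: borel_measurable_induct)
  case (cong f h)
  have sp: "space M1 = space M" "space M2 = space M" "space M3 = space M"
    using assms(1-3) by (auto dest: sets_eq_imp_space_eq)
  have "integral\<^sup>N M1 f = integral\<^sup>N M1 h" "integral\<^sup>N M2 f = integral\<^sup>N M2 h"
    "integral\<^sup>N M3 f = integral\<^sup>N M3 h" using cong by (auto intro!: nn_integral_cong simp: sp)
  with cong show ?case by simp
next
  case (set B)
  then show ?case using le[of B] assms(1-3) by simp
next
  case (mult u c)
  then have "c * integral\<^sup>N M1 u \<le> c * (integral\<^sup>N M2 u + integral\<^sup>N M3 u)"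
    by (intro mult_left_mono) auto
  moreover have "u \<in> borel_measurable M1" "u \<in> borel_measurable M2" "u \<in> borel_measurable M3"
    using mult assms(1-3) by (auto cong: measurable_cong_sets)
  ultimately show ?case by (simp add: nn_integral_cmult distrib_left)
next
  case (add u w)
  have "u \<in> borel_measurable M1" "u \<in> borel_measurable M2" "u \<in> borel_measurable M3"
     "w \<in> borel_measurable M1" "w \<in> borel_measurable M2" "w \<in> borel_measurable M3"
    using add assms(1-3) by (auto cong: measurable_cong_sets)
  then show ?case using add_mono[OF add.IH] add by (simp add: nn_integral_add ac_simps)
next
  case (seq U)
  have m: "U i \<in> borel_measurable M1" "U i \<in> borel_measurable M2" "U i \<in> borel_measurable M3" for i
    using seq assms(1-3) by (auto cong: measurable_cong_sets)
  have eq: "integral\<^sup>N N (Sup (range U)) = (SUP i. integral\<^sup>N N (U i))"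
    if "\<And>i. U i \<in> borel_measurable N" for N
    using nn_integral_monotone_convergence_SUP[OF seq(3) that]
    by (simp add: image_comp SUP_apply[abs_def])
  show ?case unfolding eq[OF m(1)]
  proof (rule SUP_least)
    fix i
    have "integral\<^sup>N M1 (U i) \<le> integral\<^sup>N M2 (U i) + integral\<^sup>N M3 (U i)" by (rule seq)
    also have "\<dots> \<le> integral\<^sup>N M2 (Sup (range U)) + integral\<^sup>N M3 (Sup (range U))"
      unfolding eq[OF m(2)] eq[OF m(3)] by (intro add_mono SUP_upper) auto
    finally show "integral\<^sup>N M1 (U i) \<le> integral\<^sup>N M2 (Sup (range U)) + integral\<^sup>N M3 (Sup (range U))" .
  qed
qed

text \<open>
  If \<open>M3\<close> dominates the signed measure \<open>M1 - M2\<close>, then \<open>M1 \<le> M2 + M3\<close> and \<open>M2 \<le> M1 + M3\<close>, and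
  both inequalities may be integrated against the nonnegative functions \<open>K + \<psi>\<close> and \<open>K - \<psi>\<close>.
  Adding the estimate for \<open>K + \<psi>\<close> to the one for \<open>K - \<psi>\<close> with the roles of \<open>M1\<close> and \<open>M2\<close> exchanged
  cancels \<open>K (M1 S - M2 S)\<close> and leaves twice the claim.
\<close>

lemma abs_integral_diff_le:
  fixes \<psi> :: "real \<Rightarrow> real"
  assumes sets: "sets M1 = sets borel" "sets M2 = sets borel" "sets M3 = sets borel"
    and S: "S \<in> sets borel"
    and fin: "emeasure M1 S < \<infinity>" "emeasure M2 S < \<infinity>" "emeasure M3 S < \<infinity>"
    and dom: "\<And>B. B \<in> sets borel \<Longrightarrow> B \<subseteq> S \<Longrightarrow> \<bar>measure M1 B - measure M2 B\<bar> \<le> measure M3 B"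
    and \<psi>: "set_borel_measurable borel S \<psi>" "\<And>s. s \<in> S \<Longrightarrow> \<bar>\<psi> s\<bar> \<le> K" and K: "0 \<le> K"
  shows "\<bar>(LINT s:S|M1. \<psi> s) - (LINT s:S|M2. \<psi> s)\<bar> \<le> K * measure M3 S"
proof -
  define h where "h = (\<lambda>s. indicator S s * \<psi> s)"
  have h[measurable]: "h \<in> borel_measurable borel"
    using \<psi>(1) by (simp add: h_def set_borel_measurable_def)
  have habs: "\<bar>h s\<bar> \<le> K * indicator S s" for s
    using \<psi>(2)[of s] by (auto simp: h_def indicator_def)
  have int: "integrable M h" "integrable M (\<lambda>s. K * indicator S s)"
    "integral\<^sup>L M (\<lambda>s. K * indicator S s) = K * measure M S"
    if "sets M = sets borel" "emeasure M S < \<infinity>" for M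
  proof -
    show 1: "integrable M (\<lambda>s. K * indicator S s :: real)"
      using that S by (intro integrable_mult_right integrable_real_indicator) auto
    show "integrable M h"
    proof (rule Bochner_Integration.integrable_bound[OF 1])
      show "h \<in> borel_measurable M" using that(1) h by (simp cong: measurable_cong_sets)
      show "AE s in M. norm (h s) \<le> norm (K * indicator S s)"
        using habs K by (intro AE_I2) (simp add: abs_mult)
    qed
    show "integral\<^sup>L M (\<lambda>s. K * indicator S s) = K * measure M S"
      using that S sets_eq_imp_space_eq[OF that(1)] by (simp)
  qed
  \<comment> \<open>Restricting to \<open>S\<close> makes the hypothesis, which concerns subsets of \<open>S\<close> only, one about all measurable sets.\<close>
  have main: "integral\<^sup>L N1 w \<le> integral\<^sup>L N2 w + integral\<^sup>L M3 w"
    if N: "sets N1 = sets borel" "sets N2 = sets borel" "emeasure N1 S < \<infinity>" "emeasure N2 S < \<infinity>"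
      and d: "\<And>B. B \<in> sets borel \<Longrightarrow> B \<subseteq> S \<Longrightarrow> measure N1 B \<le> measure N2 B + measure M3 B"
      and w: "w = (\<lambda>s. K * indicator S s + h s) \<or> w = (\<lambda>s. K * indicator S s - h s)" for N1 N2 w
  proof -
    have w0: "0 \<le> w s" for s using w habs[of s] by auto
    have wS: "w s = w s * indicator S s" for s using w by (auto simp: h_def indicator_def)
    have wb[measurable]: "w \<in> borel_measurable borel" using w S by auto
    have wi: "integrable M w" if "sets M = sets borel" "emeasure M S < \<infinity>" for M
      using w int(1,2)[OF that] by auto
    have nn: "ennreal (integral\<^sup>L M w) = (\<integral>\<^sup>+s. ennreal (w s) \<partial>restrict_space M S)"
      if "sets M = sets borel" "emeasure M S < \<infinity>" for M
    proof -
      have "ennreal (integral\<^sup>L M w) = (\<integral>\<^sup>+s. ennreal (w s) \<partial>M)"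
        by (rule nn_integral_eq_integral[symmetric]) (use wi[OF that] w0 in auto)
      also have "\<dots> = (\<integral>\<^sup>+s. ennreal (w s) * indicator S s \<partial>M)"
        by (rule nn_integral_cong) (subst wS, simp add: indicator_def)
      also have "\<dots> = (\<integral>\<^sup>+s. ennreal (w s) \<partial>restrict_space M S)"
        using that S sets_eq_imp_space_eq[OF that(1)]
        by (intro nn_integral_restrict_space[symmetric]) auto
      finally show ?thesis .
    qed
    have "(\<integral>\<^sup>+s. ennreal (w s) \<partial>restrict_space N1 S) \<le>
      (\<integral>\<^sup>+s. ennreal (w s) \<partial>restrict_space N2 S) + (\<integral>\<^sup>+s. ennreal (w s) \<partial>restrict_space M3 S)"
    proof (rule nn_integral_le_add[where M="restrict_space borel S"])
      show "sets (restrict_space N1 S) = sets (restrict_space borel S)"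
        "sets (restrict_space N2 S) = sets (restrict_space borel S)"
        "sets (restrict_space M3 S) = sets (restrict_space borel S)"
        using N sets by (auto intro!: sets_restrict_space_cong)
      show "(\<lambda>s. ennreal (w s)) \<in> borel_measurable (restrict_space borel S)"
        by (rule measurable_restrict_space1) simp
      fix B assume "B \<in> sets (restrict_space borel S)"
      then have B: "B \<in> sets borel" "B \<subseteq> S"
        using S by (auto simp: sets_restrict_space_iff)
      have em: "emeasure (restrict_space M S) B = ennreal (measure M B)"
        if "sets M = sets borel" "emeasure M S < \<infinity>" for M
      proof -
        have "emeasure M B \<le> emeasure M S" using B S that by (intro emeasure_mono) auto
        then have "emeasure M B \<noteq> \<infinity>" using that by auto
        then have "emeasure M B = ennreal (measure M B)" by (simp add: emeasure_eq_ennreal_measure)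
        then show ?thesis using B S that sets_eq_imp_space_eq[OF that(1)]
          by (subst emeasure_restrict_space) auto
      qed
      show "emeasure (restrict_space N1 S) B \<le>
          emeasure (restrict_space N2 S) B + emeasure (restrict_space M3 S) B"
        using d[OF B] N sets fin by (simp add: em flip: ennreal_plus)
    qed
    then have "ennreal (integral\<^sup>L N1 w) \<le> ennreal (integral\<^sup>L N2 w) + ennreal (integral\<^sup>L M3 w)"
      using N sets fin by (simp add: nn)
    then have "ennreal (integral\<^sup>L N1 w) \<le> ennreal (integral\<^sup>L N2 w + integral\<^sup>L M3 w)"
      using w0 by (subst ennreal_plus) auto
    then show ?thesis using w0 by (subst (asm) ennreal_le_iff) (auto intro!: add_nonneg_nonneg)
  qed
  have d1: "measure M1 B \<le> measure M2 B + measure M3 B"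
    and d2: "measure M2 B \<le> measure M1 B + measure M3 B" if "B \<in> sets borel" "B \<subseteq> S" for B
    using dom[OF that] by auto
  have LI: "(LINT s:S|M. \<psi> s) = integral\<^sup>L M h" for M
    by (simp add: set_lebesgue_integral_def h_def)
  note p1 = main[OF sets(1,2) fin(1,2) d1 disjI1[OF refl]]
   and p2 = main[OF sets(2,1) fin(2,1) d2 disjI2[OF refl]]
   and p3 = main[OF sets(1,2) fin(1,2) d1 disjI2[OF refl]]
   and p4 = main[OF sets(2,1) fin(2,1) d2 disjI1[OF refl]]
  have e: "integral\<^sup>L M (\<lambda>s. K * indicator S s + h s) = K * measure M S + integral\<^sup>L M h"
    "integral\<^sup>L M (\<lambda>s. K * indicator S s - h s) = K * measure M S - integral\<^sup>L M h"
    if "sets M = sets borel" "emeasure M S < \<infinity>" for M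
    using int[OF that] by (simp_all only: Bochner_Integration.integral_add Bochner_Integration.integral_diff)
  note e1 = e[OF sets(1) fin(1)] and e2 = e[OF sets(2) fin(2)] and e3 = e[OF sets(3) fin(3)]
  show ?thesis using p1 p2 p3 p4 unfolding LI e1 e2 e3 by linarith
qed

text \<open>
  If the supremum over partitions were not countably additive, \<^const>\<open>measure_of\<close> would yield the zero
  measure.  A single set of nonzero measure therefore certifies that the supremum is the value of the
  measure, and the partition of \<open>B\<close> into one piece gives the bound.
\<close>

lemma abs_le_total_variation_measure:
  assumes ms: "emeasure (total_variation_measure \<mu>) S \<noteq> 0" and B: "B \<in> sets borel"
  shows "ennreal \<bar>\<mu> B\<bar> \<le> emeasure (total_variation_measure \<mu>) B"
proof -
  let ?v = "\<lambda>E. SUP P\<in>{P. finite P \<and> P \<subseteq> sets borel \<and> disjoint P \<and> \<Union>P = E}.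
              \<Sum>B\<in>P. ennreal \<bar>\<mu> B\<bar>"
  have sg: "sigma_sets UNIV (sets borel) = sets (borel :: real measure)"
    using sets.sigma_sets_eq[of "borel :: real measure"] by simp
  have em: "emeasure (total_variation_measure \<mu>) E =
    (if E \<in> sets borel \<and> measure_space UNIV (sets borel) ?v then ?v E else 0)" for E
    unfolding total_variation_measure_def emeasure_measure_of_conv by (simp add: sg)
  have "measure_space UNIV (sets borel) ?v" using ms em[of S] by presburger
  then have "emeasure (total_variation_measure \<mu>) B = ?v B" using B em[of B] by presburger
  also have "ennreal \<bar>\<mu> B\<bar> \<le> ?v B"
    by (rule SUP_upper2[of "{B}"]) (use B in auto)
  finally show ?thesis .
qed

lemma sets_total_variation_measure: "sets (total_variation_measure \<mu>) = sets borel"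
  unfolding total_variation_measure_def sets_measure_of_conv
  using sets.sigma_sets_eq[of "borel :: real measure"] by simp

text \<open>
  The normalised integral has two uses: as it is not 0, the total variation measure is not the zero
  measure and so dominates the signed measure; as it is 1 and \<open>g \<ge> 1\<close>, the total variation on
  \<open>[a, b]\<close> is at most 1.
\<close>

lemma abs_stieltjes_integral_le:
  fixes g \<psi> :: "real \<Rightarrow> real"
  assumes g: "\<And>s. s \<in> {a..b} \<Longrightarrow> 1 \<le> g s"
    and bv: "bounded_variation f a b"
    and one: "(LINT s:{a..b}|total_variation_measure (stieltjes_signed_measure f a b). g s) = 1"
    and \<psi>: "continuous_on {a..b} \<psi>" "\<And>s. s \<in> {a..b} \<Longrightarrow> \<bar>\<psi> s\<bar> \<le> K" and ab: "a \<le> b"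
  shows "\<bar>stieltjes_integral f a b \<psi>\<bar> \<le> K"
proof -
  define M1 where "M1 = mono_stieltjes_measure (variation f a) a b"
  define M2 where "M2 = mono_stieltjes_measure (\<lambda>x. variation f a x - f x) a b"
  define M3 where "M3 = total_variation_measure (stieltjes_signed_measure f a b)"
  have s1: "sets M1 = sets borel" and s2: "sets M2 = sets borel" and s3: "sets M3 = sets borel"
    by (simp_all add: M1_def M2_def M3_def mono_stieltjes_measure_def sets_total_variation_measure)
  have f1: "emeasure M1 {a..b} < \<infinity>" unfolding M1_def
  proof (intro emeasure_mono_stieltjes_finite mono_onI ab)
    fix x y assume "x \<in> {a..b}" "y \<in> {a..b}" "x \<le> y"
    then show "variation f a x \<le> variation f a y"
      using variation_increment[OF bv, of x y] by auto
  qed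
  have f2: "emeasure M2 {a..b} < \<infinity>" unfolding M2_def
  proof (intro emeasure_mono_stieltjes_finite mono_onI ab)
    fix x y assume "x \<in> {a..b}" "y \<in> {a..b}" "x \<le> y"
    then show "variation f a x - f x \<le> variation f a y - f y"
      using variation_increment[OF bv, of x y] by (auto simp: abs_if split: if_splits)
  qed
  have K0: "0 \<le> K" using \<psi>(2)[of a] ab by auto
  \<comment> \<open>A non-integrable function has integral 0 by convention, which the normalisation excludes.\<close>
  have gi: "set_integrable M3 {a..b} g"
  proof (rule ccontr)
    assume "\<not> set_integrable M3 {a..b} g"
    then have "(LINT s:{a..b}|M3. g s) = 0"
      unfolding set_integrable_def set_lebesgue_integral_def by (rule not_integrable_integral_eq)
    with one show False by (simp add: M3_def)
  qed
  have gint: "(\<integral>\<^sup>+s. ennreal (indicator {a..b} s *\<^sub>R g s) \<partial>M3) = 1"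
  proof -
    have "AE s in M3. 0 \<le> indicator {a..b} s *\<^sub>R g s"
      using g by (intro AE_I2) (fastforce simp: indicator_def)
    from nn_integral_eq_integral[OF gi[unfolded set_integrable_def] this] one
    show ?thesis by (simp add: M3_def set_lebesgue_integral_def)
  qed
  have le1: "emeasure M3 {a..b} \<le> 1"
  proof -
    have "emeasure M3 {a..b} = (\<integral>\<^sup>+s. indicator {a..b} s \<partial>M3)" using s3 by simp
    also have "\<dots> \<le> (\<integral>\<^sup>+s. ennreal (indicator {a..b} s *\<^sub>R g s) \<partial>M3)"
      using g by (intro nn_integral_mono) (auto simp: indicator_def)
    finally show ?thesis using gint by simp
  qed
  have ne: "emeasure M3 {a..b} \<noteq> 0"
  proof
    assume "emeasure M3 {a..b} = 0"
    then have "{a..b} \<in> null_sets M3" using s3 by (intro null_setsI) auto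
    then have "AE s in M3. ennreal (indicator {a..b} s *\<^sub>R g s) = 0"
      by (rule AE_I') (auto simp: indicator_def)
    then have "(\<integral>\<^sup>+s. ennreal (indicator {a..b} s *\<^sub>R g s) \<partial>M3) = (\<integral>\<^sup>+s. 0 \<partial>M3)"
      by (rule nn_integral_cong_AE)
    with gint show False by simp
  qed
  have f3: "emeasure M3 {a..b} < \<infinity>"
    using le1 by (rule le_less_trans) simp
  have dom: "\<bar>measure M1 B - measure M2 B\<bar> \<le> measure M3 B"
    if "B \<in> sets borel" "B \<subseteq> {a..b}" for B
  proof -
    have "emeasure M3 B \<le> emeasure M3 {a..b}" using that s3 by (intro emeasure_mono) auto
    then have "emeasure M3 B < \<infinity>" using f3 by (rule le_less_trans)
    then have "emeasure M3 B = ennreal (measure M3 B)"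
      by (intro emeasure_eq_ennreal_measure) auto
    moreover have "ennreal \<bar>measure M1 B - measure M2 B\<bar> \<le> emeasure M3 B"
      using abs_le_total_variation_measure[OF ne[unfolded M3_def] that(1)]
      by (simp add: stieltjes_signed_measure_def M1_def M2_def M3_def)
    ultimately show ?thesis by (simp add: ennreal_le_iff)
  qed
  have "\<bar>(LINT s:{a..b}|M1. \<psi> s) - (LINT s:{a..b}|M2. \<psi> s)\<bar> \<le> K * measure M3 {a..b}"
    using \<psi> K0 borel_measurable_continuous_on_indicator[OF _ \<psi>(1)]
    by (intro abs_integral_diff_le s1 s2 s3 f1 f2 f3 dom) (auto simp: set_borel_measurable_def)
  also have "\<dots> \<le> K * 1"
  proof (rule mult_left_mono[OF _ K0])
    have "ennreal (measure M3 {a..b}) \<le> ennreal 1"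
      using le1 f3 by (simp add: emeasure_eq_ennreal_measure)
    then show "measure M3 {a..b} \<le> 1" by simp
  qed
  finally show ?thesis by (simp add: stieltjes_integral_def M1_def M2_def)
qed

section \<open>The weighted phase space and its dual\<close>

lemma infnorm_real: "infnorm (x::real) = \<bar>x\<bar>"
  by (simp add: infnorm_def Basis_real_def)

lemma infnorm_le_iff_component:
  "infnorm (x::real^'n) \<le> c \<longleftrightarrow> (\<forall>i. \<bar>x $ i\<bar> \<le> c)"
proof
  show "infnorm x \<le> c" if "\<forall>i. \<bar>x $ i\<bar> \<le> c"
    unfolding infnorm_cart by (rule cSup_least) (use that in auto)
qed (use component_le_infnorm_cart order_trans in blast)

lemma weight_ge_1: "phase_weight g \<Longrightarrow> s \<le> 0 \<Longrightarrow> 1 \<le> g s"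
  and weight_antimono: "phase_weight g \<Longrightarrow> r \<le> s \<Longrightarrow> s \<le> 0 \<Longrightarrow> g s \<le> g r"
  by (auto simp: phase_weight_def monotone_on_def)

lemma Cg0_eventually_le:
  assumes w: "phase_weight g" and \<phi>: "\<phi> \<in> Cg0 g" and c: "0 < c"
  obtains N where "N \<le> 0" "\<And>s. s \<le> N \<Longrightarrow> infnorm (\<phi> s) \<le> c * g s"
proof -
  have "((\<lambda>s. infnorm (\<phi> s) / g s) \<longlongrightarrow> 0) at_bot" using \<phi> by (simp add: Cg0_def)
  then have "eventually (\<lambda>s. infnorm (\<phi> s) / g s < c) at_bot" using c by (rule order_tendstoD)
  then obtain N where N: "\<And>s. s \<le> N \<Longrightarrow> infnorm (\<phi> s) / g s < c"
    by (auto simp: eventually_at_bot_linorder)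
  show ?thesis
  proof (rule that[of "min N 0"])
    fix s assume "s \<le> min N 0"
    then show "infnorm (\<phi> s) \<le> c * g s"
      using N[of s] weight_ge_1[OF w, of s] by (simp add: field_simps)
  qed simp
qed

text \<open>
  The supremum in \<^const>\<open>Cg0_norm\<close> is meaningful only with this bound: near \<open>-\<infinity>\<close> the quotient is small,
  and the rest of the half-line is compact.
\<close>

lemma Cg0_bdd_above:
  assumes w: "phase_weight g" and \<phi>: "\<phi> \<in> Cg0 g"
  shows "bdd_above ((\<lambda>s. infnorm (\<phi> s) / g s) ` {..0})"
proof -
  obtain N where N: "N \<le> 0" "\<And>s. s \<le> N \<Longrightarrow> infnorm (\<phi> s) \<le> 1 * g s"
    using Cg0_eventually_le[OF w \<phi>, of 1] by auto
  have "continuous_on {N..0} (\<lambda>s. infnorm (\<phi> s) / g s)"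
  proof (rule continuous_on_divide)
    show "continuous_on {N..0} (\<lambda>s. infnorm (\<phi> s))"
      using \<phi> by (intro continuous_on_infnorm) (auto simp: Cg0_def intro: continuous_on_subset)
    show "continuous_on {N..0} g" using w by (auto simp: phase_weight_def intro: continuous_on_subset)
    show "\<forall>s\<in>{N..0}. g s \<noteq> 0" using weight_ge_1[OF w] by fastforce
  qed
  then have "compact ((\<lambda>s. infnorm (\<phi> s) / g s) ` {N..0})"
    by (rule compact_continuous_image) simp
  then have "bdd_above ((\<lambda>s. infnorm (\<phi> s) / g s) ` {N..0})"
    by (intro bounded_imp_bdd_above compact_imp_bounded)
  moreover have "bdd_above ((\<lambda>s. infnorm (\<phi> s) / g s) ` {..N})"
  proof (rule bdd_aboveI2[of _ _ 1])
    fix s assume "s \<in> {..N}"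
    then show "infnorm (\<phi> s) / g s \<le> 1"
      using N weight_ge_1[OF w, of s] by (simp add: field_simps)
  qed
  moreover have "{..0} = {..N} \<union> {N..0}" using N(1) by auto
  ultimately show ?thesis by (simp add: image_Un)
qed

lemma infnorm_le_Cg0_norm:
  assumes w: "phase_weight g" and \<phi>: "\<phi> \<in> Cg0 g" and s: "s \<le> 0"
  shows "infnorm (\<phi> s) \<le> Cg0_norm g \<phi> * g s"
proof -
  have "infnorm (\<phi> s) / g s \<le> Cg0_norm g \<phi>"
    unfolding Cg0_norm_def using s by (intro cSUP_upper Cg0_bdd_above[OF w \<phi>]) auto
  then show ?thesis using weight_ge_1[OF w s] by (simp add: field_simps)
qed

lemma Cg0_norm_le:
  assumes w: "phase_weight g" and "\<And>s. s \<le> 0 \<Longrightarrow> infnorm (\<phi> s) \<le> c * g s"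
  shows "Cg0_norm g \<phi> \<le> c"
  unfolding Cg0_norm_def
proof (rule cSUP_least)
  fix s :: real assume "s \<in> {..0}"
  then show "infnorm (\<phi> s) / g s \<le> c"
    using assms(2)[of s] weight_ge_1[OF w, of s] by (simp add: field_simps)
qed simp

lemma Cg0_norm_nonneg:
  assumes w: "phase_weight g" and \<phi>: "\<phi> \<in> Cg0 g"
  shows "0 \<le> Cg0_norm g \<phi>"
proof -
  have "0 \<le> infnorm (\<phi> 0)" by (rule infnorm_pos_le)
  then show ?thesis using infnorm_le_Cg0_norm[OF w \<phi>, of 0] w by (auto simp: phase_weight_def)
qed

lemma Cg0_add:
  assumes "phase_weight g" "\<phi> \<in> Cg0 g" "\<psi> \<in> Cg0 g"
  shows "(\<lambda>s. \<phi> s + \<psi> s) \<in> Cg0 g"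
proof -
  have "((\<lambda>s. infnorm (\<phi> s + \<psi> s) / g s) \<longlongrightarrow> 0) at_bot"
  proof (rule tendsto_sandwich[where f="\<lambda>_. 0"])
    show "((\<lambda>s. infnorm (\<phi> s) / g s + infnorm (\<psi> s) / g s) \<longlongrightarrow> 0) at_bot"
      using tendsto_add[of "\<lambda>s. infnorm (\<phi> s) / g s" 0 at_bot "\<lambda>s. infnorm (\<psi> s) / g s" 0]
        assms(2,3) by (simp add: Cg0_def)
    show "eventually (\<lambda>s. infnorm (\<phi> s + \<psi> s) / g s \<le> infnorm (\<phi> s) / g s + infnorm (\<psi> s) / g s) at_bot"
      using eventually_le_at_bot[of 0]
    proof eventually_elim
      case (elim s)
      then show ?case using weight_ge_1[OF assms(1), of s] infnorm_triangle[of "\<phi> s" "\<psi> s"]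
        by (simp add: field_simps)
    qed
    show "eventually (\<lambda>s. 0 \<le> infnorm (\<phi> s + \<psi> s) / g s) at_bot"
      using eventually_le_at_bot[of 0]
    proof eventually_elim
      case (elim s)
      then show ?case using weight_ge_1[OF assms(1), of s] infnorm_pos_le[of "\<phi> s + \<psi> s"] by simp
    qed
  qed simp
  then show ?thesis using assms by (auto simp: Cg0_def intro: continuous_on_add)
qed

lemma Cg0_cmult:
  fixes \<phi> :: "real \<Rightarrow> real"
  assumes "\<phi> \<in> Cg0 g"
  shows "(\<lambda>s. c * \<phi> s) \<in> Cg0 g"
proof -
  have "((\<lambda>s. \<bar>c\<bar> * (infnorm (\<phi> s) / g s)) \<longlongrightarrow> \<bar>c\<bar> * 0) at_bot"
    using assms by (intro tendsto_mult tendsto_const) (simp add: Cg0_def)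
  then show ?thesis using assms
    by (auto simp: Cg0_def infnorm_real abs_mult intro: continuous_intros)
qed

lemma Cg0_diff:
  fixes \<phi> :: "real \<Rightarrow> real"
  assumes "phase_weight g" "\<phi> \<in> Cg0 g" "\<psi> \<in> Cg0 g"
  shows "(\<lambda>s. \<phi> s - \<psi> s) \<in> Cg0 g"
  using Cg0_add[OF assms(1,2) Cg0_cmult[OF assms(3), of "-1"]] by simp

lemma Cg0_component:
  fixes \<phi> :: "real \<Rightarrow> real^'n"
  assumes w: "phase_weight g" and "\<phi> \<in> Cg0 g"
  shows "(\<lambda>s. \<phi> s $ j) \<in> Cg0 g"
proof -
  have "((\<lambda>s. infnorm (\<phi> s $ j) / g s) \<longlongrightarrow> 0) at_bot"
  proof (rule tendsto_sandwich[where f="\<lambda>_. 0"])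
    show "((\<lambda>s. infnorm (\<phi> s) / g s) \<longlongrightarrow> 0) at_bot" using assms by (simp add: Cg0_def)
    show "eventually (\<lambda>s. infnorm (\<phi> s $ j) / g s \<le> infnorm (\<phi> s) / g s) at_bot"
      using eventually_le_at_bot[of 0]
    proof eventually_elim
      case (elim s)
      then show ?case using weight_ge_1[OF w, of s] component_le_infnorm_cart[of "\<phi> s" j]
        by (simp add: infnorm_real divide_right_mono)
    qed
    show "eventually (\<lambda>s. 0 \<le> infnorm (\<phi> s $ j) / g s) at_bot"
      using eventually_le_at_bot[of 0]
    proof eventually_elim
      case (elim s)
      then show ?case using weight_ge_1[OF w, of s] by (simp add: infnorm_real)
    qed
  qed simp
  then show ?thesis using assms by (auto simp: Cg0_def intro: continuous_intros)
qed

lemma Cg0_norm_triangle: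
  fixes \<phi> :: "real \<Rightarrow> real"
  assumes w: "phase_weight g" and "\<phi> \<in> Cg0 g" "\<psi> \<in> Cg0 g"
  shows "Cg0_norm g \<phi> \<le> Cg0_norm g \<psi> + Cg0_norm g (\<lambda>s. \<phi> s - \<psi> s)"
proof (rule Cg0_norm_le[OF w])
  fix s :: real assume s: "s \<le> 0"
  note infnorm_le_Cg0_norm[OF w assms(3) s] infnorm_le_Cg0_norm[OF w Cg0_diff[OF w assms(2,3)] s]
  then show "infnorm (\<phi> s) \<le> (Cg0_norm g \<psi> + Cg0_norm g (\<lambda>s. \<phi> s - \<psi> s)) * g s"
    by (simp add: infnorm_real distrib_right)
qed

lemma Cg0_dual_diff_arg:
  assumes w: "phase_weight g" and L: "L \<in> Cg0_dual g" and "\<phi> \<in> Cg0 g" "\<psi> \<in> Cg0 g"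
  shows "L (\<lambda>s. \<phi> s - \<psi> s) = L \<phi> - L \<psi>"
proof -
  have m: "(\<lambda>s. -1 * \<psi> s) \<in> Cg0 g" by (rule Cg0_cmult[OF assms(4)])
  have "L (\<lambda>s. \<phi> s + -1 * \<psi> s) = L \<phi> + L (\<lambda>s. -1 * \<psi> s)"
    using L assms(3) m by (auto simp: Cg0_dual_def)
  also have "L (\<lambda>s. -1 * \<psi> s) = -1 * L \<psi>"
    using L assms(4) unfolding Cg0_dual_def by blast
  finally show ?thesis by simp
qed

lemma Cg0_dual_diff:
  assumes w: "phase_weight g" and L: "L \<in> Cg0_dual g" "L' \<in> Cg0_dual g"
  shows "(\<lambda>\<psi>. L \<psi> - L' \<psi>) \<in> Cg0_dual g"
proof -
  obtain K K' where K: "\<And>\<phi>. \<phi>\<in>Cg0 g \<Longrightarrow> \<bar>L \<phi>\<bar> \<le> K * Cg0_norm g \<phi>"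
    "\<And>\<phi>. \<phi>\<in>Cg0 g \<Longrightarrow> \<bar>L' \<phi>\<bar> \<le> K' * Cg0_norm g \<phi>"
    using L unfolding Cg0_dual_def by blast
  have "\<bar>L \<phi> - L' \<phi>\<bar> \<le> (K + K') * Cg0_norm g \<phi>" if "\<phi> \<in> Cg0 g" for \<phi>
    using K[OF that] by (simp add: distrib_right)
  then have "\<exists>K. \<forall>\<phi>\<in>Cg0 g. \<bar>L \<phi> - L' \<phi>\<bar> \<le> K * Cg0_norm g \<phi>" by blast
  moreover have "L (\<lambda>s. \<phi> s + \<psi> s) = L \<phi> + L \<psi>" "L' (\<lambda>s. \<phi> s + \<psi> s) = L' \<phi> + L' \<psi>"
    "L (\<lambda>s. c * \<phi> s) = c * L \<phi>" "L' (\<lambda>s. c * \<phi> s) = c * L' \<phi>"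
    if "\<phi> \<in> Cg0 g" "\<psi> \<in> Cg0 g" for \<phi> \<psi> c using L that unfolding Cg0_dual_def by blast+
  ultimately show ?thesis by (simp add: Cg0_dual_def right_diff_distrib)
qed

lemma dual_norm_bdd_above:
  assumes w: "phase_weight g" and L: "L \<in> Cg0_dual g"
  shows "bdd_above ((\<lambda>\<phi>. \<bar>L \<phi>\<bar>) ` {\<phi> \<in> Cg0 g. Cg0_norm g \<phi> \<le> 1})"
proof -
  obtain K where K: "\<And>\<phi>. \<phi>\<in>Cg0 g \<Longrightarrow> \<bar>L \<phi>\<bar> \<le> K * Cg0_norm g \<phi>"
    using L unfolding Cg0_dual_def by blast
  show ?thesis
  proof (rule bdd_aboveI2[of _ _ "\<bar>K\<bar>"])
    fix \<phi> :: "real \<Rightarrow> real" assume "\<phi> \<in> {\<phi> \<in> Cg0 g. Cg0_norm g \<phi> \<le> 1}"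
    then have \<phi>: "\<phi> \<in> Cg0 g" "Cg0_norm g \<phi> \<le> 1" by auto
    have "K * Cg0_norm g \<phi> \<le> \<bar>K\<bar> * 1"
      using Cg0_norm_nonneg[OF w \<phi>(1)] \<phi>(2) by (intro mult_mono) auto
    then show "\<bar>L \<phi>\<bar> \<le> \<bar>K\<bar>" using K[OF \<phi>(1)] by simp
  qed
qed

text \<open>
  Normalising \<open>\<psi>\<close> reduces the claim to the unit ball.  A function of norm zero cannot be normalised, but
  any bound for \<open>L\<close> shows that \<open>L\<close> vanishes there; this also means that \<open>L\<close> does not see the values of
  \<open>\<psi>\<close> to the right of 0.
\<close>

lemma abs_le_dual_norm:
  assumes w: "phase_weight g" and L: "L \<in> Cg0_dual g" and \<psi>: "\<psi> \<in> Cg0 g"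
  shows "\<bar>L \<psi>\<bar> \<le> dual_norm g L * Cg0_norm g \<psi>"
proof (cases "Cg0_norm g \<psi> = 0")
  case True
  obtain K where "\<bar>L \<psi>\<bar> \<le> K * Cg0_norm g \<psi>" using L \<psi> by (auto simp: Cg0_dual_def)
  with True show ?thesis by simp
next
  case False
  define c where "c = Cg0_norm g \<psi>"
  have c: "0 < c" using False Cg0_norm_nonneg[OF w \<psi>] by (simp add: c_def)
  let ?u = "\<lambda>s. inverse c * \<psi> s"
  have u: "?u \<in> Cg0 g" by (rule Cg0_cmult[OF \<psi>])
  have "Cg0_norm g ?u \<le> 1"
  proof (rule Cg0_norm_le[OF w])
    fix s :: real assume "s \<le> 0"
    from infnorm_le_Cg0_norm[OF w \<psi> this] c show "infnorm (?u s) \<le> 1 * g s"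
      by (simp add: infnorm_real abs_mult c_def[symmetric] field_simps)
  qed
  with u have "\<bar>L ?u\<bar> \<le> dual_norm g L"
    unfolding dual_norm_def by (intro cSUP_upper dual_norm_bdd_above[OF w L]) auto
  moreover have "L ?u = inverse c * L \<psi>" using L \<psi> unfolding Cg0_dual_def by blast
  ultimately have "inverse c * \<bar>L \<psi>\<bar> \<le> dual_norm g L" using c by (simp add: abs_mult)
  then have "c * (inverse c * \<bar>L \<psi>\<bar>) \<le> c * dual_norm g L" using c by (intro mult_left_mono) auto
  moreover have "c * (inverse c * \<bar>L \<psi>\<bar>) = \<bar>L \<psi>\<bar>" using c by simp
  ultimately have "\<bar>L \<psi>\<bar> \<le> c * dual_norm g L" by (simp only:)
  then show ?thesis by (simp add: c_def mult.commute)
qed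

lemma dual_norm_nonneg:
  assumes w: "phase_weight g" and L: "L \<in> Cg0_dual g"
  shows "0 \<le> dual_norm g L"
proof -
  have 0: "(\<lambda>_. 0::real) \<in> Cg0 g" by (simp add: Cg0_def infnorm_real)
  have "Cg0_norm g (\<lambda>_. 0::real) \<le> 1"
    by (rule Cg0_norm_le[OF w]) (use weight_ge_1[OF w] in \<open>force simp: infnorm_real\<close>)
  with 0 have "\<bar>L (\<lambda>_. 0)\<bar> \<le> dual_norm g L"
    unfolding dual_norm_def by (intro cSUP_upper dual_norm_bdd_above[OF w L]) auto
  then show ?thesis by linarith
qed

lemma dual_norm_triangle:
  assumes w: "phase_weight g" and L: "L \<in> Cg0_dual g" "L' \<in> Cg0_dual g"
  shows "dual_norm g L \<le> dual_norm g L' + dual_norm g (\<lambda>\<psi>. L \<psi> - L' \<psi>)"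
  unfolding dual_norm_def[of g L]
proof (rule cSUP_least)
  have "(\<lambda>_. 0::real) \<in> Cg0 g" by (simp add: Cg0_def infnorm_real)
  moreover have "Cg0_norm g (\<lambda>_. 0::real) \<le> 1"
    by (rule Cg0_norm_le[OF w]) (use weight_ge_1[OF w] in \<open>force simp: infnorm_real\<close>)
  ultimately show "{\<phi> \<in> Cg0 g. Cg0_norm g \<phi> \<le> 1} \<noteq> ({} :: (real \<Rightarrow> real) set)" by blast
  fix \<phi> :: "real \<Rightarrow> real" assume "\<phi> \<in> {\<phi> \<in> Cg0 g. Cg0_norm g \<phi> \<le> 1}"
  note cSUP_upper[OF this dual_norm_bdd_above[OF w L(2)]]
    cSUP_upper[OF this dual_norm_bdd_above[OF w Cg0_dual_diff[OF w L]]]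
  then have "\<bar>L' \<phi>\<bar> \<le> dual_norm g L'" "\<bar>L \<phi> - L' \<phi>\<bar> \<le> dual_norm g (\<lambda>\<psi>. L \<psi> - L' \<psi>)"
    unfolding dual_norm_def by this+
  then show "\<bar>L \<phi>\<bar> \<le> dual_norm g L' + dual_norm g (\<lambda>\<psi>. L \<psi> - L' \<psi>)" by linarith
qed

text \<open>
  Moving the history forward in time evaluates the old tail at a later argument \<open>t - \<sigma> + s \<ge> s\<close>, where the
  weight is smaller; so the tail only becomes smaller relative to the weight.
\<close>

lemma shift_in_Cg0:
  fixes x :: "real \<Rightarrow> real"
  assumes w: "phase_weight g" and x: "continuous_on UNIV x" and h: "(\<lambda>s. x (\<sigma> + s)) \<in> Cg0 g"
    and t: "\<sigma> \<le> t"
  shows "(\<lambda>s. x (t + s)) \<in> Cg0 g"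
proof -
  have "((\<lambda>s. infnorm (x (t + s)) / g s) \<longlongrightarrow> 0) at_bot"
  proof (rule tendstoI)
    fix c :: real assume c: "0 < c"
    then obtain N where N: "N \<le> 0" "\<And>s. s \<le> N \<Longrightarrow> infnorm (x (\<sigma> + s)) \<le> (c/2) * g s"
      using Cg0_eventually_le[OF w h, of "c/2"] by auto
    show "eventually (\<lambda>s. dist (infnorm (x (t + s)) / g s) 0 < c) at_bot"
      using eventually_le_at_bot[of "N + \<sigma> - t"]
    proof eventually_elim
      case (elim s)
      have "\<bar>x (t + s)\<bar> \<le> (c/2) * g (t - \<sigma> + s)"
        using N(2)[of "t - \<sigma> + s"] elim by (simp add: infnorm_real)
      also have "\<dots> \<le> (c/2) * g s"
        using elim t N(1) c by (intro mult_left_mono weight_antimono[OF w]) auto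
      finally have "\<bar>x (t + s)\<bar> \<le> (c/2) * g s" .
      moreover have g1: "1 \<le> g s" using elim t N(1) by (intro weight_ge_1[OF w]) auto
      moreover have "(c/2) * g s < c * g s" using c g1 by simp
      ultimately show ?case by (simp add: infnorm_real field_simps)
    qed
  qed
  moreover have "continuous_on {..0} (\<lambda>s. x (t + s))"
    by (rule continuous_on_compose2[OF x]) (auto intro: continuous_intros)
  ultimately show ?thesis by (simp add: Cg0_def)
qed

text \<open>
  Far back in time both histories are uniformly small relative to the weight, by the same
  monotonicity; what remains is uniform continuity of \<open>x\<close> on a compact interval.
\<close>

lemma shift_continuous:
  fixes x :: "real \<Rightarrow> real"
  assumes w: "phase_weight g" and x: "continuous_on UNIV x" and h: "(\<lambda>s. x (\<sigma> + s)) \<in> Cg0 g"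
    and t: "\<sigma> \<le> t"
  shows "((\<lambda>u. Cg0_norm g (\<lambda>s. x (u + s) - x (t + s))) \<longlongrightarrow> 0) (at t within {\<sigma>..})"
proof (rule tendstoI)
  fix c :: real assume c: "0 < c"
  then obtain N where N: "N \<le> 0" "\<And>s. s \<le> N \<Longrightarrow> infnorm (x (\<sigma> + s)) \<le> (c/4) * g s"
    using Cg0_eventually_le[OF w h, of "c/4"] by auto
  have "uniformly_continuous_on {\<sigma> + N - 1..t + 1} x"
    by (rule compact_uniformly_continuous) (auto intro: continuous_on_subset[OF x])
  then obtain d where d: "d > 0"
    "\<And>r r'. r \<in> {\<sigma> + N - 1..t + 1} \<Longrightarrow> r' \<in> {\<sigma> + N - 1..t + 1} \<Longrightarrow> dist r' r < d \<Longrightarrow> dist (x r') (x r) < c/2"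
    using c unfolding uniformly_continuous_on_def by (metis half_gt_zero)
  have tail: "\<bar>x (u + s)\<bar> \<le> (c/4) * g s" if "\<sigma> \<le> u" "s \<le> 0" "u + s \<le> \<sigma> + N" for u s
  proof -
    have "\<bar>x (u + s)\<bar> \<le> (c/4) * g (u + s - \<sigma>)"
      using N(2)[of "u + s - \<sigma>"] that by (simp add: infnorm_real)
    also have "\<dots> \<le> (c/4) * g s"
      using that N(1) c by (intro mult_left_mono weight_antimono[OF w]) auto
    finally show ?thesis .
  qed
  have bound: "Cg0_norm g (\<lambda>s. x (u + s) - x (t + s)) \<le> c/2"
    if u: "\<sigma> \<le> u" "\<bar>u - t\<bar> < min d 1" for u
  proof (rule Cg0_norm_le[OF w])
    fix s :: real assume s: "s \<le> 0"
    show "infnorm (x (u + s) - x (t + s)) \<le> c/2 * g s"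
    proof (cases "u + s \<le> \<sigma> + N \<and> t + s \<le> \<sigma> + N")
      case True
      then have "\<bar>x (u + s)\<bar> \<le> (c/4) * g s" "\<bar>x (t + s)\<bar> \<le> (c/4) * g s"
        using tail[of u s] tail[of t s] u s t by auto
      then show ?thesis unfolding infnorm_real by linarith
    next
      case False
      have "dist (x (u + s)) (x (t + s)) < c/2"
        by (rule d(2)) (use False u s in \<open>auto simp: dist_real_def\<close>)
      moreover have "c/2 * 1 \<le> c/2 * g s" using c weight_ge_1[OF w s] by (intro mult_left_mono) auto
      ultimately show ?thesis by (simp add: infnorm_real dist_real_def)
    qed
  qed
  have "eventually (\<lambda>u. u \<in> {\<sigma>..} \<and> dist u t < min d 1) (at t within {\<sigma>..})"
    using d(1) by (auto simp: eventually_at intro!: exI[of _ "min d 1"])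
  then show "eventually (\<lambda>u. dist (Cg0_norm g (\<lambda>s. x (u + s) - x (t + s))) 0 < c) (at t within {\<sigma>..})"
  proof eventually_elim
    case (elim u)
    have "0 \<le> Cg0_norm g (\<lambda>s. x (u + s) - x (t + s))"
      using elim t by (intro Cg0_norm_nonneg[OF w] Cg0_diff[OF w] shift_in_Cg0[OF w x h]) auto
    then show ?case using bound[of u] elim c by (auto simp: dist_real_def)
  qed
qed

text \<open>
  Both the functional and its argument vary:
  \<open>L u x\<^sub>u - L t x\<^sub>t = (L u - L t) x\<^sub>u + L t (x\<^sub>u - x\<^sub>t)\<close>.
\<close>

lemma functional_of_shift_continuous:
  fixes x :: "real \<Rightarrow> real"
  assumes w: "phase_weight g" and x: "continuous_on UNIV x" and h: "(\<lambda>s. x (\<sigma> + s)) \<in> Cg0 g"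
    and L: "\<And>t. 0 \<le> t \<Longrightarrow> L t \<in> Cg0_dual g" and Lc: "dual_continuous_on g {0..} L" and \<sigma>: "0 \<le> \<sigma>"
  shows "continuous_on {\<sigma>..} (\<lambda>t. L t (\<lambda>s. x (t + s)))"
  unfolding continuous_on_def
proof
  fix t assume "t \<in> {\<sigma>..}"
  then have t: "\<sigma> \<le> t" by simp
  let ?F = "at t within {\<sigma>..}"
  let ?N = "\<lambda>u. Cg0_norm g (\<lambda>s. x (u + s) - x (t + s))"
  let ?d = "\<lambda>u. dual_norm g (\<lambda>\<psi>. L u \<psi> - L t \<psi>)"
  let ?c = "Cg0_norm g (\<lambda>s. x (t + s))"
  have N0: "(?N \<longlongrightarrow> 0) ?F" by (rule shift_continuous[OF w x h t])
  have "(?d \<longlongrightarrow> 0) (at t within {0..})" using Lc t \<sigma> by (simp add: dual_continuous_on_def)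
  then have d0: "(?d \<longlongrightarrow> 0) ?F" by (rule tendsto_within_subset) (use \<sigma> in auto)
  have "((\<lambda>u. ?d u * (?c + ?N u) + dual_norm g (L t) * ?N u) \<longlongrightarrow> 0 * (?c + 0) + dual_norm g (L t) * 0) ?F"
    by (intro tendsto_intros N0 d0)
  then have lim: "((\<lambda>u. ?d u * (?c + ?N u) + dual_norm g (L t) * ?N u) \<longlongrightarrow> 0) ?F" by simp
  have "eventually (\<lambda>u. u \<in> {\<sigma>..}) ?F" by (simp add: eventually_at_filter)
  then have "eventually (\<lambda>u. norm (L u (\<lambda>s. x (u + s)) - L t (\<lambda>s. x (t + s)))
    \<le> ?d u * (?c + ?N u) + dual_norm g (L t) * ?N u) ?F"
  proof eventually_elim
    case (elim u)
    then have u: "\<sigma> \<le> u" by simp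
    have xu: "(\<lambda>s. x (u + s)) \<in> Cg0 g" and xt: "(\<lambda>s. x (t + s)) \<in> Cg0 g"
      by (rule shift_in_Cg0[OF w x h], fact)+
    have Lu: "L u \<in> Cg0_dual g" and Lt: "L t \<in> Cg0_dual g" using L t u \<sigma> by auto
    have dd: "(\<lambda>\<psi>. L u \<psi> - L t \<psi>) \<in> Cg0_dual g" by (rule Cg0_dual_diff[OF w Lu Lt])
    have "\<bar>L u (\<lambda>s. x (u + s)) - L t (\<lambda>s. x (u + s))\<bar> \<le> ?d u * Cg0_norm g (\<lambda>s. x (u + s))"
      by (rule abs_le_dual_norm[OF w dd xu])
    also have "\<dots> \<le> ?d u * (?c + ?N u)"
      by (intro mult_left_mono Cg0_norm_triangle[OF w xu xt] dual_norm_nonneg[OF w dd])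
    finally have 1: "\<bar>L u (\<lambda>s. x (u + s)) - L t (\<lambda>s. x (u + s))\<bar> \<le> ?d u * (?c + ?N u)" .
    have "\<bar>L t (\<lambda>s. x (u + s)) - L t (\<lambda>s. x (t + s))\<bar> \<le> dual_norm g (L t) * ?N u"
      unfolding Cg0_dual_diff_arg[OF w Lt xu xt, symmetric]
      by (rule abs_le_dual_norm[OF w Lt Cg0_diff[OF w xu xt]])
    with 1 show ?case by simp
  qed
  from Lim_null_comparison[OF this lim]
  show "((\<lambda>u. L u (\<lambda>s. x (u + s))) \<longlongrightarrow> L t (\<lambda>s. x (t + s))) ?F"
    by (simp add: LIM_zero_iff)
qed

lemma dual_norm_continuous:
  assumes w: "phase_weight g" and L: "\<And>t. 0 \<le> t \<Longrightarrow> L t \<in> Cg0_dual g"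
    and Lc: "dual_continuous_on g {0..} L"
  shows "continuous_on {0..} (\<lambda>t. dual_norm g (L t))"
  unfolding continuous_on_def
proof
  fix t :: real assume t: "t \<in> {0..}"
  have lim: "((\<lambda>u. dual_norm g (\<lambda>\<psi>. L u \<psi> - L t \<psi>)) \<longlongrightarrow> 0) (at t within {0..})"
    using Lc t by (simp add: dual_continuous_on_def)
  have "eventually (\<lambda>u. u \<in> {0..}) (at t within {0..})" by (simp add: eventually_at_filter)
  then have "eventually (\<lambda>u. norm (dual_norm g (L u) - dual_norm g (L t))
      \<le> dual_norm g (\<lambda>\<psi>. L u \<psi> - L t \<psi>)) (at t within {0..})"
  proof eventually_elim
    case (elim u)
    then have Lu: "L u \<in> Cg0_dual g" and Lt: "L t \<in> Cg0_dual g" using L t by auto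
    have "dual_norm g (\<lambda>\<psi>. L t \<psi> - L u \<psi>) = dual_norm g (\<lambda>\<psi>. L u \<psi> - L t \<psi>)"
      by (simp add: dual_norm_def abs_minus_commute)
    then show ?case using dual_norm_triangle[OF w Lu Lt] dual_norm_triangle[OF w Lt Lu] by simp
  qed
  from Lim_null_comparison[OF this lim]
  show "((\<lambda>u. dual_norm g (L u)) \<longlongrightarrow> dual_norm g (L t)) (at t within {0..})"
    by (simp add: LIM_zero_iff)
qed

section \<open>Existence and uniqueness of solutions\<close>

text \<open>
  The initial value problem is treated for an arbitrary norm-continuous family of bounded functionals
  \<open>L i j t\<close>, applied to the \<open>j\<close>-th component of the history.
\<close>

locale linear_delay_system =
  fixes g :: "real \<Rightarrow> real" and D :: "real \<Rightarrow> real^'n^'n"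
    and L :: "'n \<Rightarrow> 'n \<Rightarrow> real \<Rightarrow> (real \<Rightarrow> real) \<Rightarrow> real"
  assumes weight: "phase_weight g"
    and D_cont: "\<And>i j. continuous_on {0..} (\<lambda>t. D t $ i $ j)"
    and L_dual: "\<And>i j t. 0 \<le> t \<Longrightarrow> L i j t \<in> Cg0_dual g"
    and L_cont: "\<And>i j. dual_continuous_on g {0..} (L i j)"
begin

definition rhs :: "'n \<Rightarrow> real \<Rightarrow> (real \<Rightarrow> real^'n) \<Rightarrow> real" where
  "rhs i t x = - (\<Sum>j\<in>UNIV. D t $ i $ j * x t $ j) + (\<Sum>j\<in>UNIV. L i j t (\<lambda>s. x (t + s) $ j))"

definition gain :: "real \<Rightarrow> real" where
  "gain t = (\<Sum>i\<in>UNIV. \<Sum>j\<in>UNIV. \<bar>D t $ i $ j\<bar> + dual_norm g (L i j t))"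

text \<open>
  The candidates in the Picard iteration: continuous continuations of the history \<open>\<phi>\<close> prescribed at
  time \<open>\<sigma>\<close>.  Any two of them agree up to \<open>\<sigma>\<close>, which is why differences can be measured on \<open>[\<sigma>, t]\<close> alone.
\<close>

definition extends :: "real \<Rightarrow> (real \<Rightarrow> real^'n) \<Rightarrow> (real \<Rightarrow> real^'n) \<Rightarrow> bool" where
  "extends \<sigma> \<phi> x \<longleftrightarrow> continuous_on UNIV x \<and> (\<forall>s\<le>0. x (\<sigma> + s) = \<phi> s)"

lemma gain_nonneg: "0 \<le> t \<Longrightarrow> 0 \<le> gain t"
  unfolding gain_def by (intro sum_nonneg add_nonneg_nonneg dual_norm_nonneg[OF weight L_dual]) auto

lemma gain_continuous: "continuous_on {0..} gain"
  unfolding gain_def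
  by (intro continuous_intros D_cont dual_norm_continuous[OF weight L_dual L_cont])

lemma extends_past: "extends \<sigma> \<phi> x \<Longrightarrow> t \<le> \<sigma> \<Longrightarrow> x t = \<phi> (t - \<sigma>)"
  unfolding extends_def by (drule conjunct2, drule spec[of _ "t - \<sigma>"]) simp

lemma extends_in_Cg0:
  assumes "\<phi> \<in> Cg0 g" "extends \<sigma> \<phi> x"
  shows "(\<lambda>s. x (\<sigma> + s) $ j) \<in> Cg0 g" and "continuous_on UNIV (\<lambda>t. x t $ j)"
proof -
  show 1: "continuous_on UNIV (\<lambda>t. x t $ j)"
    using assms(2) by (auto simp: extends_def intro: continuous_intros)
  have e: "x (\<sigma> + s) = \<phi> s" if "s \<le> 0" for s using assms(2) that by (simp add: extends_def)
  have \<phi>: "(\<lambda>s. \<phi> s $ j) \<in> Cg0 g" by (rule Cg0_component[OF weight assms(1)])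
  have "continuous_on {..0} (\<lambda>s. x (\<sigma> + s) $ j)"
    by (rule continuous_on_compose2[OF 1]) (auto intro: continuous_intros)
  moreover have "((\<lambda>s. infnorm (x (\<sigma> + s) $ j) / g s) \<longlongrightarrow> 0) at_bot"
  proof (rule Lim_transform_eventually)
    show "((\<lambda>s. infnorm (\<phi> s $ j) / g s) \<longlongrightarrow> 0) at_bot" using \<phi> by (simp add: Cg0_def)
    show "eventually (\<lambda>s. infnorm (\<phi> s $ j) / g s = infnorm (x (\<sigma> + s) $ j) / g s) at_bot"
      using eventually_le_at_bot[of 0] by eventually_elim (simp add: e)
  qed
  ultimately show "(\<lambda>s. x (\<sigma> + s) $ j) \<in> Cg0 g" by (simp add: Cg0_def)
qed

lemma rhs_continuous:
  assumes "\<phi> \<in> Cg0 g" "extends \<sigma> \<phi> x" "0 \<le> \<sigma>"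
  shows "continuous_on {\<sigma>..} (\<lambda>t. rhs i t x)"
proof -
  have "continuous_on {\<sigma>..} (\<lambda>t. D t $ i $ j)" for j
    by (rule continuous_on_subset[OF D_cont]) (use assms(3) in auto)
  moreover have "continuous_on {\<sigma>..} (\<lambda>t. x t $ j)" for j
    by (rule continuous_on_subset[OF extends_in_Cg0(2)[OF assms(1,2)]]) auto
  moreover have "continuous_on {\<sigma>..} (\<lambda>t. L i j t (\<lambda>s. x (t + s) $ j))" for j
    by (rule functional_of_shift_continuous[OF weight extends_in_Cg0(2,1)[OF assms(1,2)] L_dual L_cont assms(3)])
  ultimately show ?thesis unfolding rhs_def
    by (intro continuous_on_add continuous_on_minus continuous_on_sum continuous_on_mult)
qed

text \<open>
  The histories of \<open>x\<close> and \<open>y\<close> agree before \<open>\<sigma>\<close>, and \<open>g \<ge> 1\<close>, so a uniform bound for the difference on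
  \<open>[\<sigma>, t]\<close> bounds the phase space norm of the difference of the histories at time \<open>t\<close>.
\<close>

lemma rhs_lipschitz:
  assumes \<phi>: "\<phi> \<in> Cg0 g" and x: "extends \<sigma> \<phi> x" and y: "extends \<sigma> \<phi> y" and t: "0 \<le> \<sigma>" "\<sigma> \<le> t"
    and h: "\<And>r j. r \<in> {\<sigma>..t} \<Longrightarrow> \<bar>x r $ j - y r $ j\<bar> \<le> h"
  shows "\<bar>rhs i t x - rhs i t y\<bar> \<le> gain t * h"
proof -
  have h0: "0 \<le> h" using h[of t] t by (meson abs_ge_zero atLeastAtMost_iff order_refl order_trans)
  have Lb: "\<bar>L i j t (\<lambda>s. x (t + s) $ j) - L i j t (\<lambda>s. y (t + s) $ j)\<bar> \<le> dual_norm g (L i j t) * h" for j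
  proof -
    have xt: "(\<lambda>s. x (t + s) $ j) \<in> Cg0 g" and yt: "(\<lambda>s. y (t + s) $ j) \<in> Cg0 g"
      using shift_in_Cg0[OF weight extends_in_Cg0(2,1)[OF \<phi> x] t(2)]
        shift_in_Cg0[OF weight extends_in_Cg0(2,1)[OF \<phi> y] t(2)] by auto
    have Lt: "L i j t \<in> Cg0_dual g" using t by (intro L_dual) auto
    have "Cg0_norm g (\<lambda>s. x (t + s) $ j - y (t + s) $ j) \<le> h"
    proof (rule Cg0_norm_le[OF weight])
      fix s :: real assume s: "s \<le> 0"
      have "\<bar>x (t + s) $ j - y (t + s) $ j\<bar> \<le> h"
      proof (cases "\<sigma> \<le> t + s")
        case True
        then show ?thesis using h[of "t+s"] s by auto
      next
        case False
        then show ?thesis using h0 extends_past[OF x, of "t + s"] extends_past[OF y, of "t + s"] by simp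
      qed
      also have "h * 1 \<le> h * g s" using h0 weight_ge_1[OF weight s] by (intro mult_left_mono)
      finally show "infnorm (x (t + s) $ j - y (t + s) $ j) \<le> h * g s" by (simp add: infnorm_real)
    qed
    then have "dual_norm g (L i j t) * Cg0_norm g (\<lambda>s. x (t + s) $ j - y (t + s) $ j)
        \<le> dual_norm g (L i j t) * h"
      by (intro mult_left_mono dual_norm_nonneg[OF weight Lt])
    then show ?thesis
      using abs_le_dual_norm[OF weight Lt Cg0_diff[OF weight xt yt]]
      unfolding Cg0_dual_diff_arg[OF weight Lt xt yt] by linarith
  qed
  have "\<bar>rhs i t x - rhs i t y\<bar> = \<bar>\<Sum>j\<in>UNIV. (L i j t (\<lambda>s. x (t + s) $ j) - L i j t (\<lambda>s. y (t + s) $ j))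
      - D t $ i $ j * (x t $ j - y t $ j)\<bar>"
    by (simp add: rhs_def sum_subtractf right_diff_distrib)
  also have "\<dots> \<le> (\<Sum>j\<in>UNIV. \<bar>(L i j t (\<lambda>s. x (t + s) $ j) - L i j t (\<lambda>s. y (t + s) $ j))
      - D t $ i $ j * (x t $ j - y t $ j)\<bar>)" by (rule sum_abs)
  also have "\<dots> \<le> (\<Sum>j\<in>UNIV. (\<bar>D t $ i $ j\<bar> + dual_norm g (L i j t)) * h)"
  proof (rule sum_mono)
    fix j
    have "\<bar>D t $ i $ j * (x t $ j - y t $ j)\<bar> \<le> \<bar>D t $ i $ j\<bar> * h"
      unfolding abs_mult using h[of t j] t by (intro mult_left_mono) auto
    then show "\<bar>(L i j t (\<lambda>s. x (t + s) $ j) - L i j t (\<lambda>s. y (t + s) $ j))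
        - D t $ i $ j * (x t $ j - y t $ j)\<bar> \<le> (\<bar>D t $ i $ j\<bar> + dual_norm g (L i j t)) * h"
      using Lb[of j] by (simp add: distrib_right)
  qed
  also have "\<dots> = (\<Sum>j\<in>UNIV. \<bar>D t $ i $ j\<bar> + dual_norm g (L i j t)) * h" by (simp add: sum_distrib_right)
  also have "\<dots> \<le> gain t * h"
  proof (rule mult_right_mono[OF _ h0])
    have "(\<Sum>j\<in>UNIV. \<bar>D t $ k $ j\<bar> + dual_norm g (L k j t)) \<ge> 0" for k
      using t by (intro sum_nonneg add_nonneg_nonneg dual_norm_nonneg[OF weight L_dual]) auto
    then show "(\<Sum>j\<in>UNIV. \<bar>D t $ i $ j\<bar> + dual_norm g (L i j t)) \<le> gain t"
      unfolding gain_def by (intro member_le_sum[where f="\<lambda>i. \<Sum>j\<in>UNIV. \<bar>D t $ i $ j\<bar> + dual_norm g (L i j t)"]) auto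
  qed
  finally show ?thesis .
qed

definition picard :: "real \<Rightarrow> (real \<Rightarrow> real^'n) \<Rightarrow> (real \<Rightarrow> real^'n) \<Rightarrow> real \<Rightarrow> real^'n" where
  "picard \<sigma> \<phi> x t = (if t \<le> \<sigma> then \<phi> (t - \<sigma>)
     else (\<chi> i. \<phi> 0 $ i + integral {\<sigma>..t} (\<lambda>s. rhs i s x)))"

lemma picard_ge:
  "\<sigma> \<le> t \<Longrightarrow> picard \<sigma> \<phi> x t $ i = \<phi> 0 $ i + integral {\<sigma>..t} (\<lambda>s. rhs i s x)"
  by (cases "t = \<sigma>") (auto simp: picard_def)

lemma glued_continuous:
  fixes \<phi> x :: "real \<Rightarrow> 'a::topological_space"
  assumes "continuous_on {..0} \<phi>" and "\<And>b. continuous_on {\<sigma>..b} x" and "\<And>t. t \<le> \<sigma> \<Longrightarrow> x t = \<phi> (t - \<sigma>)"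
  shows "continuous_on UNIV x"
proof -
  have 1: "continuous_on {..\<sigma>} x"
    by (rule continuous_on_eq[OF continuous_on_compose2[OF assms(1), of _ "\<lambda>t. t - \<sigma>"]])
       (auto intro: continuous_intros simp: assms(3))
  show ?thesis
    unfolding continuous_on_eq_continuous_at[OF open_UNIV]
  proof
    fix t
    have "continuous_on ({..\<sigma>} \<union> {\<sigma>..max t \<sigma> + 1}) x"
      using 1 assms(2) by (intro continuous_on_closed_Un) auto
    then have "continuous_on {..<max t \<sigma> + 1} x" by (rule continuous_on_subset) auto
    then show "isCont x t" by (rule continuous_on_interior) (auto simp: interior_open)
  qed
qed

lemma picard_extends:
  assumes "\<phi> \<in> Cg0 g" "extends \<sigma> \<phi> x" "0 \<le> \<sigma>"
  shows "extends \<sigma> \<phi> (picard \<sigma> \<phi> x)"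
  unfolding extends_def
proof
  show "\<forall>s\<le>0. picard \<sigma> \<phi> x (\<sigma> + s) = \<phi> s" by (simp add: picard_def)
  show "continuous_on UNIV (picard \<sigma> \<phi> x)"
  proof (rule glued_continuous)
    show "continuous_on {..0} \<phi>" using assms by (simp add: Cg0_def)
    fix b
    have "continuous_on {\<sigma>..b} (\<lambda>t. \<chi> i. \<phi> 0 $ i + integral {\<sigma>..t} (\<lambda>s. rhs i s x))"
      by (intro continuous_on_vec_lambda continuous_intros indefinite_integral_continuous_1
          integrable_continuous_real) (auto intro: continuous_on_subset[OF rhs_continuous[OF assms]])
    then show "continuous_on {\<sigma>..b} (picard \<sigma> \<phi> x)"
      by (rule continuous_on_eq) (auto simp: vec_eq_iff picard_ge)
  qed (simp add: picard_def)
qed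

text \<open>
  The weight of a Bielecki norm.  Its logarithmic derivative is \<open>2 * gain\<close>, so integrating
  \<open>gain * growth\<close> gives back at most half of \<open>growth\<close>, and the Picard operator contracts by the
  factor 1/2 on every interval, however long.
\<close>

definition growth :: "real \<Rightarrow> real \<Rightarrow> real" where
  "growth \<sigma> t = exp (integral {\<sigma>..t} (\<lambda>s. 2 * gain s))"

lemma growth_ge_1:
  assumes "0 \<le> \<sigma>" "\<sigma> \<le> t" shows "1 \<le> growth \<sigma> t"
  using assms unfolding growth_def
  by (auto intro!: integral_nonneg gain_nonneg integrable_continuous_real
        continuous_on_subset[OF gain_continuous] continuous_intros)

lemma growth_mono:
  assumes "0 \<le> \<sigma>" "\<sigma> \<le> r" "r \<le> t" shows "growth \<sigma> r \<le> growth \<sigma> t"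
  using assms unfolding growth_def
  by (auto intro!: integral_subset_le gain_nonneg integrable_continuous_real
        continuous_on_subset[OF gain_continuous] continuous_intros)

lemma integral_gain_growth:
  assumes "0 \<le> \<sigma>" "\<sigma> \<le> t"
  shows "((\<lambda>s. gain s * growth \<sigma> s) has_integral (growth \<sigma> t - 1) / 2) {\<sigma>..t}"
proof -
  have c: "continuous_on {\<sigma>..t} gain"
    using assms by (auto intro!: continuous_on_subset[OF gain_continuous])
  have "((\<lambda>s. gain s * growth \<sigma> s) has_integral growth \<sigma> t / 2 - growth \<sigma> \<sigma> / 2) {\<sigma>..t}"
  proof (rule fundamental_theorem_of_calculus[OF assms(2)])
    fix s assume s: "s \<in> {\<sigma>..t}"
    from integral_has_real_derivative[OF c s]
    have "((\<lambda>s. growth \<sigma> s / 2) has_real_derivative gain s * growth \<sigma> s) (at s within {\<sigma>..t})"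
      unfolding growth_def by (auto intro!: derivative_eq_intros simp: mult_ac)
    then show "((\<lambda>s. growth \<sigma> s / 2) has_vector_derivative gain s * growth \<sigma> s) (at s within {\<sigma>..t})"
      by (simp add: has_real_derivative_iff_has_vector_derivative)
  qed
  then show ?thesis by (simp add: growth_def diff_divide_distrib)
qed

lemma picard_contraction:
  assumes \<phi>: "\<phi> \<in> Cg0 g" and x: "extends \<sigma> \<phi> x" and y: "extends \<sigma> \<phi> y" and \<sigma>: "0 \<le> \<sigma>"
    and C: "\<And>r j. r \<in> {\<sigma>..b} \<Longrightarrow> \<bar>x r $ j - y r $ j\<bar> \<le> C * growth \<sigma> r"
    and t: "t \<in> {\<sigma>..b}"
  shows "\<bar>picard \<sigma> \<phi> x t $ i - picard \<sigma> \<phi> y t $ i\<bar> \<le> C / 2 * growth \<sigma> t"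
proof -
  have "0 \<le> C * growth \<sigma> t" using C[OF t] by (meson abs_ge_zero order_trans)
  then have C0: "0 \<le> C" using growth_ge_1[of \<sigma> t] t \<sigma> by (auto simp: zero_le_mult_iff)
  have ix: "(\<lambda>s. rhs i s x) integrable_on {\<sigma>..t}" and iy: "(\<lambda>s. rhs i s y) integrable_on {\<sigma>..t}"
    by (auto intro!: integrable_continuous_real continuous_on_subset[OF rhs_continuous[OF \<phi> x \<sigma>]]
        continuous_on_subset[OF rhs_continuous[OF \<phi> y \<sigma>]])
  have "\<sigma> \<le> t" using t by simp
  note G = has_integral_mult_right[OF integral_gain_growth[OF \<sigma> this], of C]
  have "norm (integral {\<sigma>..t} (\<lambda>s. rhs i s x - rhs i s y)) \<le> integral {\<sigma>..t} (\<lambda>s. C * (gain s * growth \<sigma> s))"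
  proof (rule integral_norm_bound_integral)
    show "(\<lambda>s. rhs i s x - rhs i s y) integrable_on {\<sigma>..t}" by (rule integrable_diff[OF ix iy])
    show "(\<lambda>s. C * (gain s * growth \<sigma> s)) integrable_on {\<sigma>..t}" using G by (rule has_integral_integrable)
    fix s assume s: "s \<in> {\<sigma>..t}"
    have "\<bar>rhs i s x - rhs i s y\<bar> \<le> gain s * (C * growth \<sigma> s)"
    proof (rule rhs_lipschitz[OF \<phi> x y \<sigma>])
      fix r j assume r: "r \<in> {\<sigma>..s}"
      have "C * growth \<sigma> r \<le> C * growth \<sigma> s" using r s \<sigma> C0 by (intro mult_left_mono growth_mono) auto
      then show "\<bar>x r $ j - y r $ j\<bar> \<le> C * growth \<sigma> s" using C[of r j] r s t by auto
    qed (use s in auto)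
    then show "norm (rhs i s x - rhs i s y) \<le> C * (gain s * growth \<sigma> s)" by (simp add: mult_ac)
  qed
  also have "\<dots> = C * ((growth \<sigma> t - 1) / 2)" using G by (rule integral_unique)
  also have "\<dots> \<le> C / 2 * growth \<sigma> t" using C0 by (simp add: field_simps)
  finally show ?thesis using t by (simp add: picard_ge integral_diff[OF ix iy])
qed

lemma fixed_point_solves:
  assumes \<phi>: "\<phi> \<in> Cg0 g" and x: "extends \<sigma> \<phi> x" and \<sigma>: "0 \<le> \<sigma>"
    and fix_x: "\<And>t. \<sigma> \<le> t \<Longrightarrow> x t = picard \<sigma> \<phi> x t" and t: "\<sigma> \<le> t"
  shows "((\<lambda>u. x u $ i) has_real_derivative rhs i t x) (at t within {\<sigma>..})"
proof -
  have "((\<lambda>u. integral {\<sigma>..u} (\<lambda>s. rhs i s x)) has_real_derivative rhs i t x) (at t within {\<sigma>..t+1})"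
    by (rule integral_has_real_derivative)
       (use t in \<open>auto intro: continuous_on_subset[OF rhs_continuous[OF \<phi> x \<sigma>]]\<close>)
  then have "((\<lambda>u. \<phi> 0 $ i + integral {\<sigma>..u} (\<lambda>s. rhs i s x)) has_real_derivative rhs i t x) (at t within {\<sigma>..t+1})"
    by (auto intro!: derivative_eq_intros)
  then have "((\<lambda>u. x u $ i) has_real_derivative rhs i t x) (at t within {\<sigma>..t+1})"
    by (rule has_field_derivative_transform_within[of _ _ _ _ 1]) (use t fix_x in \<open>auto simp: picard_ge\<close>)
  moreover have "at t within {\<sigma>..t+1} = at t within {\<sigma>..}"
    by (rule at_within_nhd[of _ "{..<t+1}"]) auto
  ultimately show ?thesis by simp
qed

lemma solution_fixed_point:
  assumes \<phi>: "\<phi> \<in> Cg0 g" and \<sigma>: "0 \<le> \<sigma>" and h: "\<And>s. s \<le> 0 \<Longrightarrow> x (\<sigma> + s) = \<phi> s"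
    and d: "\<And>t i. \<sigma> \<le> t \<Longrightarrow> ((\<lambda>u. x u $ i) has_real_derivative rhs i t x) (at t within {\<sigma>..})"
  shows "extends \<sigma> \<phi> x" and "\<And>t. \<sigma> \<le> t \<Longrightarrow> x t = picard \<sigma> \<phi> x t"
proof -
  show "extends \<sigma> \<phi> x" unfolding extends_def
  proof
    show "continuous_on UNIV x"
    proof (rule glued_continuous)
      show "continuous_on {..0} \<phi>" using \<phi> by (simp add: Cg0_def)
      show "x t = \<phi> (t - \<sigma>)" if "t \<le> \<sigma>" for t using h[of "t - \<sigma>"] that by simp
      fix b
      have c: "continuous_on {\<sigma>..} (\<lambda>u. x u $ i)" for i
        by (rule DERIV_continuous_on) (use d in auto)
      have "continuous_on {\<sigma>..b} (\<lambda>u. \<chi> i. x u $ i)"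
        by (intro continuous_on_vec_lambda continuous_on_subset[OF c]) auto
      then show "continuous_on {\<sigma>..b} x" by simp
    qed
  qed (use h in auto)
  fix t assume t: "\<sigma> \<le> t"
  have "x t $ i = picard \<sigma> \<phi> x t $ i" for i
  proof -
    have "((\<lambda>s. rhs i s x) has_integral x t $ i - x \<sigma> $ i) {\<sigma>..t}"
    proof (rule fundamental_theorem_of_calculus[OF t])
      fix s assume "s \<in> {\<sigma>..t}"
      then have "((\<lambda>u. x u $ i) has_real_derivative rhs i s x) (at s within {\<sigma>..t})"
        using d[of s i] by (auto intro: DERIV_subset)
      then show "((\<lambda>u. x u $ i) has_vector_derivative rhs i s x) (at s within {\<sigma>..t})"
        by (simp add: has_real_derivative_iff_has_vector_derivative)
    qed
    then show ?thesis using t h[of 0] by (simp add: picard_ge integral_unique)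
  qed
  then show "x t = picard \<sigma> \<phi> x t" by (simp add: vec_eq_iff)
qed

lemma extends_difference_bound:
  assumes "extends \<sigma> \<phi> x" "extends \<sigma> \<phi> y" "0 \<le> \<sigma>"
  obtains C where "\<And>r j. r \<in> {\<sigma>..b} \<Longrightarrow> \<bar>x r $ j - y r $ j\<bar> \<le> C * growth \<sigma> r"
proof -
  have "continuous_on {\<sigma>..b} (\<lambda>r. infnorm (x r - y r))"
    using assms by (intro continuous_on_infnorm continuous_on_diff)
      (auto simp: extends_def intro: continuous_on_subset)
  then have "bounded ((\<lambda>r. infnorm (x r - y r)) ` {\<sigma>..b})"
    by (intro compact_imp_bounded compact_continuous_image) auto
  then obtain C where "\<forall>z\<in>(\<lambda>r. infnorm (x r - y r)) ` {\<sigma>..b}. norm z \<le> C"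
    unfolding bounded_iff by blast
  then have C: "infnorm (x r - y r) \<le> C" if "r \<in> {\<sigma>..b}" for r
    using that by (auto simp: abs_le_iff)
  show ?thesis
  proof (rule that[of C])
    fix r j assume r: "r \<in> {\<sigma>..b}"
    have "0 \<le> C" using C[OF r] infnorm_pos_le[of "x r - y r"] by linarith
    then have "C * 1 \<le> C * growth \<sigma> r" using r assms by (intro mult_left_mono growth_ge_1) auto
    then show "\<bar>x r $ j - y r $ j\<bar> \<le> C * growth \<sigma> r"
      using C[OF r] component_le_infnorm_cart[of "x r - y r" j] by simp
  qed
qed

text \<open>
  Two fixed points differ by at most \<open>C * growth\<close> on a compact interval; applying the contraction again
  and again divides \<open>C\<close> by 2.
\<close>

lemma fixed_point_unique:
  assumes \<phi>: "\<phi> \<in> Cg0 g" and x: "extends \<sigma> \<phi> x" and y: "extends \<sigma> \<phi> y" and \<sigma>: "0 \<le> \<sigma>"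
    and fx: "\<And>t. \<sigma> \<le> t \<Longrightarrow> x t = picard \<sigma> \<phi> x t" and fy: "\<And>t. \<sigma> \<le> t \<Longrightarrow> y t = picard \<sigma> \<phi> y t"
  shows "x = y"
proof
  fix t
  show "x t = y t"
  proof (cases "t \<le> \<sigma>")
    case True
    then show ?thesis using extends_past[OF x] extends_past[OF y] by simp
  next
    case False
    obtain C where C: "\<And>r j. r \<in> {\<sigma>..t} \<Longrightarrow> \<bar>x r $ j - y r $ j\<bar> \<le> C * growth \<sigma> r"
      using extends_difference_bound[OF x y \<sigma>, of t] by blast
    have it: "\<bar>x r $ j - y r $ j\<bar> \<le> C * (1/2)^n * growth \<sigma> r" if "r \<in> {\<sigma>..t}" for n r j
      using that
    proof (induction n arbitrary: r j)
      case 0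
      then show ?case using C by simp
    next
      case (Suc n)
      from picard_contraction[OF \<phi> x y \<sigma> Suc.IH Suc.prems, of j]
      show ?case using fx[of r] fy[of r] Suc.prems by simp
    qed
    have "x t $ j = y t $ j" for j
    proof -
      have "(\<lambda>n. C * (1/2)^n * growth \<sigma> t) \<longlonglongrightarrow> C * 0 * growth \<sigma> t"
        by (intro tendsto_intros LIMSEQ_power_zero) auto
      then have "\<bar>x t $ j - y t $ j\<bar> \<le> C * 0 * growth \<sigma> t"
        by (rule LIMSEQ_le_const) (use it[of t j] False in auto)
      then show ?thesis by simp
    qed
    then show ?thesis by (simp add: vec_eq_iff)
  qed
qed

text \<open>
  The Picard iterates form a telescoping series dominated by a geometric one, so they converge
  uniformly on each interval \<open>[\<sigma>, b]\<close>.  The iteration starts with \<open>\<phi>\<close> continued by the constant \<open>\<phi> 0\<close>.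
\<close>

lemma fixed_point_exists:
  assumes \<phi>: "\<phi> \<in> Cg0 g" and \<sigma>: "0 \<le> \<sigma>"
  obtains x where "extends \<sigma> \<phi> x" "\<And>t. \<sigma> \<le> t \<Longrightarrow> x t = picard \<sigma> \<phi> x t"
proof -
  define X where "X = (\<lambda>n. (picard \<sigma> \<phi> ^^ n) (\<lambda>t. \<phi> (min (t - \<sigma>) 0)))"
  have XS: "X (Suc n) = picard \<sigma> \<phi> (X n)" for n unfolding X_def funpow.simps by (rule comp_apply)
  have X: "extends \<sigma> \<phi> (X n)" for n
  proof (induction n)
    case 0
    have "continuous_on UNIV (\<lambda>t. \<phi> (min (t - \<sigma>) 0))"
      using \<phi> by (intro continuous_on_compose2[where g=\<phi> and f="\<lambda>t. min (t - \<sigma>) 0" and t="{..0}"]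
          continuous_on_min continuous_on_diff continuous_on_id continuous_on_const) (auto simp: Cg0_def)
    then show ?case by (simp add: extends_def X_def min_def)
  qed (simp add: XS picard_extends[OF \<phi> _ \<sigma>])
  have conv: "uniformly_convergent_on {\<sigma>..b} (\<lambda>n t. X n t $ j)" for b j
  proof -
    obtain C where C: "\<And>r j. r \<in> {\<sigma>..b} \<Longrightarrow> \<bar>X 1 r $ j - X 0 r $ j\<bar> \<le> C * growth \<sigma> r"
      using extends_difference_bound[OF X X \<sigma>, of b] by blast
    have it: "\<bar>X (Suc n) r $ j - X n r $ j\<bar> \<le> C * (1/2)^n * growth \<sigma> r" if "r \<in> {\<sigma>..b}" for n r j
      using that
    proof (induction n arbitrary: r j)
      case 0
      then show ?case using C by simp
    next
      case (Suc n)
      from picard_contraction[OF \<phi> X X \<sigma> Suc.IH Suc.prems, of j] show ?case by (simp add: XS)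
    qed
    have "uniformly_convergent_on {\<sigma>..b} (\<lambda>n t. \<Sum>k<n. X (Suc k) t $ j - X k t $ j)"
    proof (rule Weierstrass_m_test')
      show "summable (\<lambda>n. \<bar>C\<bar> * growth \<sigma> b * (1/2)^n)"
        by (intro summable_mult summable_geometric) auto
      fix n r assume r: "r \<in> {\<sigma>..b}"
      have "C * (1/2)^n * growth \<sigma> r \<le> \<bar>C\<bar> * (1/2)^n * growth \<sigma> b"
        using r \<sigma> growth_ge_1[of \<sigma> r] by (intro mult_mono growth_mono) auto
      also have "\<dots> = \<bar>C\<bar> * growth \<sigma> b * (1/2)^n" by (simp only: mult_ac)
      finally show "norm (X (Suc n) r $ j - X n r $ j) \<le> \<bar>C\<bar> * growth \<sigma> b * (1/2)^n"
        using it[OF r, of n j] unfolding real_norm_def by (rule order_trans[rotated])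
    qed
    then have "uniformly_convergent_on {\<sigma>..b} (\<lambda>n t. X n t $ j - X 0 t $ j)"
      unfolding sum_lessThan_telescope[of "\<lambda>k. X k t $ j" for t] .
    from uniformly_convergent_add[OF this uniformly_convergent_on_const[of _ "\<lambda>t. X 0 t $ j"]]
    show ?thesis by simp
  qed
  define x where "x = (\<lambda>t. \<chi> j. lim (\<lambda>n. X n t $ j))"
  have lim: "uniform_limit {\<sigma>..b} (\<lambda>n t. X n t $ j) (\<lambda>t. x t $ j) sequentially" for b j
    using conv[of b j] by (simp add: uniformly_convergent_uniform_limit_iff x_def)
  have x_hist: "x t = \<phi> (t - \<sigma>)" if "t \<le> \<sigma>" for t
  proof -
    have "X n t = \<phi> (t - \<sigma>)" for n by (rule extends_past[OF X that])
    then show ?thesis by (simp add: x_def)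
  qed
  have x: "extends \<sigma> \<phi> x" unfolding extends_def
  proof
    show "continuous_on UNIV x"
    proof (rule glued_continuous)
      show "x t = \<phi> (t - \<sigma>)" if "t \<le> \<sigma>" for t by (rule x_hist[OF that])
      show "continuous_on {..0} \<phi>" using \<phi> by (simp add: Cg0_def)
      fix b
      have "continuous_on {\<sigma>..b} (\<lambda>t. x t $ j)" for j
        by (rule uniform_limit_theorem[OF _ lim])
           (auto intro!: always_eventually continuous_on_subset[OF extends_in_Cg0(2)[OF \<phi> X]])
      then have "continuous_on {\<sigma>..b} (\<lambda>t. \<chi> j. x t $ j)" by (intro continuous_on_vec_lambda)
      then show "continuous_on {\<sigma>..b} x" by simp
    qed
  qed (simp add: x_hist)
  have "x t = picard \<sigma> \<phi> x t" if t: "\<sigma> \<le> t" for t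
  proof -
    have "(\<lambda>n. X (Suc n) t $ i) \<longlonglongrightarrow> picard \<sigma> \<phi> x t $ i" for i
    proof (rule tendstoI)
      fix c :: real assume c: "0 < c"
      define c' where "c' = c / growth \<sigma> t"
      have c': "0 < c'" "c' * growth \<sigma> t = c" using c growth_ge_1[OF \<sigma> t] by (auto simp: c'_def)
      have "eventually (\<lambda>n. \<forall>j. \<forall>r\<in>{\<sigma>..t}. dist (X n r $ j) (x r $ j) < c') sequentially"
        using uniform_limitD[OF lim c'(1)] by (intro eventually_all_finite) auto
      then show "eventually (\<lambda>n. dist (X (Suc n) t $ i) (picard \<sigma> \<phi> x t $ i) < c) sequentially"
      proof eventually_elim
        case (elim n)
        have "\<bar>X n r $ j - x r $ j\<bar> \<le> c' * growth \<sigma> r" if "r \<in> {\<sigma>..t}" for r j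
        proof -
          have "\<bar>X n r $ j - x r $ j\<bar> \<le> c' * 1" using elim that by (auto simp: dist_real_def less_imp_le)
          also have "\<dots> \<le> c' * growth \<sigma> r" using that \<sigma> c' by (intro mult_left_mono growth_ge_1) auto
          finally show ?thesis .
        qed
        then have "\<bar>picard \<sigma> \<phi> (X n) t $ i - picard \<sigma> \<phi> x t $ i\<bar> \<le> c' / 2 * growth \<sigma> t"
          by (rule picard_contraction[OF \<phi> X x \<sigma>]) (use t in auto)
        with c' c show ?case by (simp add: XS dist_real_def)
      qed
    qed
    moreover have "(\<lambda>n. X (Suc n) t $ i) \<longlonglongrightarrow> x t $ i" for i
      using tendsto_uniform_limitI[OF lim[where b=t and j=i], of t] t by (intro LIMSEQ_Suc) auto
    ultimately have "x t $ i = picard \<sigma> \<phi> x t $ i" for i using LIMSEQ_unique by blast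
    then show ?thesis by (simp add: vec_eq_iff)
  qed
  with x show ?thesis by (rule that)
qed

theorem unique_solution:
  assumes "\<phi> \<in> Cg0 g" and "0 \<le> \<sigma>"
  shows "\<exists>!x. (\<forall>s\<le>0. x (\<sigma> + s) = \<phi> s) \<and>
    (\<forall>t\<ge>\<sigma>. \<forall>i. ((\<lambda>u. x u $ i) has_real_derivative rhs i t x) (at t within {\<sigma>..}))"
proof -
  obtain x where x: "extends \<sigma> \<phi> x" "\<And>t. \<sigma> \<le> t \<Longrightarrow> x t = picard \<sigma> \<phi> x t"
    using fixed_point_exists[OF assms] by blast
  show ?thesis
  proof (rule ex1I[of _ x])
    show "(\<forall>s\<le>0. x (\<sigma> + s) = \<phi> s) \<and>
      (\<forall>t\<ge>\<sigma>. \<forall>i. ((\<lambda>u. x u $ i) has_real_derivative rhs i t x) (at t within {\<sigma>..}))"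
    proof (intro conjI allI impI)
      show "x (\<sigma> + s) = \<phi> s" if "s \<le> 0" for s using x(1) that by (simp add: extends_def)
    qed (rule fixed_point_solves[OF assms(1) x(1) assms(2) x(2)])
    fix y assume y: "(\<forall>s\<le>0. y (\<sigma> + s) = \<phi> s) \<and>
      (\<forall>t\<ge>\<sigma>. \<forall>i. ((\<lambda>u. y u $ i) has_real_derivative rhs i t y) (at t within {\<sigma>..}))"
    note fy = solution_fixed_point[OF assms y[THEN conjunct1, rule_format] y[THEN conjunct2, rule_format]]
    from fixed_point_unique[OF assms(1) fy(1) x(1) assms(2) fy(2) x(2)] show "y = x" .
  qed
qed

end

section \<open>Comparison with a decaying majorant\<close>

lemma continuous_on_atLeastI:
  fixes f :: "real \<Rightarrow> 'a::topological_space"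
  assumes "\<And>b. continuous_on {a..b} f"
  shows "continuous_on {a..} f"
  unfolding continuous_on_eq_continuous_within
proof
  fix t assume t: "t \<in> {a..}"
  then have "continuous (at t within {a..t+1}) f"
    using assms[of "t+1"] by (auto simp: continuous_on_eq_continuous_within)
  moreover have "at t within {a..t+1} = at t within {a..}"
    by (rule at_within_nhd[of _ "{..<t+1}"]) auto
  ultimately show "continuous (at t within {a..}) f" by simp
qed

lemma derivative_nonneg_at_right_end_maximum:
  fixes f :: "real \<Rightarrow> real"
  assumes ab: "a < b" and d: "(f has_real_derivative d) (at b within {a..b})"
    and max: "\<And>t. t \<in> {a..b} \<Longrightarrow> f t \<le> f b"
  shows "0 \<le> d"
proof (rule ccontr)
  assume "\<not> 0 \<le> d"
  then obtain h where h: "h > 0" "\<And>k. 0 < k \<Longrightarrow> b - k \<in> {a..b} \<Longrightarrow> k < h \<Longrightarrow> f b < f (b - k)"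
    using has_real_derivative_neg_dec_left[OF d] by auto
  define k where "k = min (h/2) (b - a)"
  have "0 < k" "k < h" "b - k \<in> {a..b}" using h(1) ab by (auto simp: k_def min_def)
  with h(2)[of k] max[of "b - k"] show False by auto
qed

text \<open>
  The heart of the proof: a first-crossing argument.  Suppose the components of \<open>x\<close> stay below the
  majorant \<open>v (W exp (- c E))\<close> up to \<open>\<sigma>\<close>.  Adding \<open>\<epsilon> (1 + t)\<close> makes this strict; let \<open>t1\<close> be the first time
  at which some component \<open>i\<close> reaches the enlarged majorant.  Over the delay interval ending at \<open>t1\<close> the
  function \<open>E\<close> varies by at most \<open>B\<close>, so there the decaying part of the majorant is at most \<open>\<beta>\<close> times its
  value at \<open>t1\<close>.  The premise \<open>key\<close>, in which \<open>Z\<close> and \<open>Y\<close> stand for the decaying and the growing part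
  of the majorant at \<open>t1\<close>, is the resulting upper bound for the derivative of \<open>\<bar>x\<^sub>i\<bar>\<close>.

  The function \<open>E\<close> need not be differentiable.  Its increments are at most those of an antiderivative
  of \<open>p i\<close>, so left of \<open>t1\<close> the majorant lies below a differentiable function that has the same value at
  \<open>t1\<close>.  Since \<open>\<bar>x\<^sub>i\<bar>\<close> stays below that function and meets it at \<open>t1\<close>, its derivative there is at least
  that of the function, \<open>- c p\<^sub>i Z + \<epsilon>\<close> times \<open>v\<^sub>i\<close>, which contradicts \<open>key\<close> because \<open>c v\<^sub>i \<le> \<kappa>\<close>.
\<close>

lemma delay_comparison:
  fixes x x' :: "real \<Rightarrow> real^'n" and v :: "real^'n" and p :: "'n \<Rightarrow> real \<Rightarrow> real"
  assumes v: "\<And>i. 0 < v $ i" and \<sigma>: "0 \<le> \<sigma>" and W: "0 \<le> W" and c: "0 < c"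
    and x_cont: "\<And>i. continuous_on {0..} (\<lambda>t. x t $ i)"
    and x_deriv: "\<And>t i. \<sigma> \<le> t \<Longrightarrow> ((\<lambda>u. x u $ i) has_real_derivative x' t $ i) (at t within {\<sigma>..})"
    and p_cont: "\<And>i. continuous_on {0..} (p i)" and p_nonneg: "\<And>t i. \<sigma> \<le> t \<Longrightarrow> 0 \<le> p i t"
    and E_cont: "continuous_on {0..} E"
    and E_incr: "\<And>r t i. \<sigma> \<le> r \<Longrightarrow> r \<le> t \<Longrightarrow> E t - E r \<le> integral {r..t} (p i)"
    and delay: "\<And>t. \<sigma> \<le> t \<Longrightarrow> \<delta> t \<le> t" 
    and E_delay: "\<And>r t. \<sigma> \<le> t \<Longrightarrow> t - \<delta> t \<le> r \<Longrightarrow> r \<le> t \<Longrightarrow> E t - E r \<le> B"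
    and \<beta>: "exp (c * B) \<le> \<beta>" and \<kappa>: "\<And>i. c * v $ i \<le> \<kappa>"
    and key: "\<And>t i s Z Y. \<sigma> \<le> t \<Longrightarrow> 0 \<le> Z \<Longrightarrow> 0 \<le> Y \<Longrightarrow> \<bar>s\<bar> = 1 \<Longrightarrow> s * x t $ i = v $ i * (Z + Y) \<Longrightarrow>
      (\<And>j. \<bar>x t $ j\<bar> \<le> v $ j * (Z + Y)) \<Longrightarrow>
      (\<And>r j. t - \<delta> t \<le> r \<Longrightarrow> r \<le> t \<Longrightarrow> \<bar>x r $ j\<bar> \<le> v $ j * (\<beta> * Z + Y)) \<Longrightarrow>
      s * x' t $ i \<le> - (\<kappa> * p i t * Z)"
    and init: "\<And>r j. 0 \<le> r \<Longrightarrow> r \<le> \<sigma> \<Longrightarrow> \<bar>x r $ j\<bar> \<le> v $ j * (W * exp (- c * E r))"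
    and t: "0 \<le> t"
  shows "\<bar>x t $ j\<bar> \<le> v $ j * (W * exp (- c * E t))"
proof -
  have strict: "\<bar>x t $ j\<bar> < v $ j * (W * exp (- c * E t) + \<epsilon> * (1 + t))"
    if \<epsilon>: "0 < \<epsilon>" and t: "0 \<le> t" for \<epsilon> t j
  proof (rule ccontr)
    assume neg: "\<not> ?thesis"
    define z where "z = (\<lambda>t. W * exp (- c * E t))"
    define \<zeta> where "\<zeta> = (\<lambda>t. z t + \<epsilon> * (1 + t))"
    have z0: "0 \<le> z r" for r using W by (simp add: z_def)
    have z_cont: "continuous_on {0..} z" unfolding z_def by (intro continuous_intros E_cont)
    have \<zeta>_cont: "continuous_on {0..} \<zeta>" unfolding \<zeta>_def by (intro continuous_intros z_cont)
    have early: "\<bar>x r $ j\<bar> < v $ j * \<zeta> r" if "0 \<le> r" "r \<le> \<sigma>" for r j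
    proof -
      have "v $ j * z r < v $ j * \<zeta> r" using v[of j] \<epsilon> that by (simp add: \<zeta>_def)
      with init[OF that, of j] show ?thesis by (simp add: z_def)
    qed
    define S where "S = (\<Union>j. {t \<in> {\<sigma>..}. v $ j * \<zeta> t \<le> \<bar>x t $ j\<bar>})"
    have "closed S" unfolding S_def
    proof (intro closed_UN ballI)
      fix j
      have "continuous_on {\<sigma>..} (\<lambda>t. v $ j * \<zeta> t)"
        by (intro continuous_intros continuous_on_subset[OF \<zeta>_cont]) (use \<sigma> in auto)
      moreover have "continuous_on {\<sigma>..} (\<lambda>t. \<bar>x t $ j\<bar>)"
        by (intro continuous_on_rabs continuous_on_subset[OF x_cont]) (use \<sigma> in auto)
      ultimately show "closed {t \<in> {\<sigma>..}. v $ j * \<zeta> t \<le> \<bar>x t $ j\<bar>}"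
        by (intro continuous_on_closed_Collect_le) auto
    qed simp
    moreover have "S \<noteq> {}"
    proof -
      have "v $ j * \<zeta> t \<le> \<bar>x t $ j\<bar>" using neg by (simp add: \<zeta>_def z_def)
      moreover from this have "\<sigma> \<le> t" using early[OF t, of j] by linarith
      ultimately show ?thesis unfolding S_def by blast
    qed
    moreover have bdd: "bdd_below S" by (rule bdd_belowI[of _ \<sigma>]) (auto simp: S_def)
    ultimately have "Inf S \<in> S" by (intro closed_contains_Inf)
    define t1 where "t1 = Inf S"
    obtain i where i: "\<sigma> \<le> t1" "v $ i * \<zeta> t1 \<le> \<bar>x t1 $ i\<bar>"
      using \<open>Inf S \<in> S\<close> unfolding S_def t1_def by blast
    have t1: "\<sigma> < t1"
      using i early[of \<sigma> i] \<sigma> by (cases "t1 = \<sigma>") auto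
    have before: "\<bar>x r $ j\<bar> < v $ j * \<zeta> r" if "0 \<le> r" "r < t1" for r j
    proof (cases "r \<le> \<sigma>")
      case False
      have "r \<notin> S" using cInf_lower[OF _ bdd, of r] that by (auto simp: t1_def)
      then show ?thesis using False unfolding S_def by (auto simp: not_le)
    qed (use early that in auto)
    \<comment> \<open>At \<open>t1\<close> itself the weak inequality survives by continuity from the left.\<close>
    have upto: "\<bar>x r $ j\<bar> \<le> v $ j * \<zeta> r" if "0 \<le> r" "r \<le> t1" for r j
    proof (cases "r < t1")
      case False
      then have r: "r = t1" using that by simp
      have "\<bar>x t1 $ j\<bar> - v $ j * \<zeta> t1 \<le> 0"
      proof (rule continuous_le_on_closure[where f="\<lambda>r. \<bar>x r $ j\<bar> - v $ j * \<zeta> r"])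
        show "continuous_on (closure {\<sigma>..<t1}) (\<lambda>r. \<bar>x r $ j\<bar> - v $ j * \<zeta> r)"
          using t1 \<sigma> by (intro continuous_intros continuous_on_subset[OF \<zeta>_cont]
              continuous_on_subset[OF x_cont]) auto
        show "t1 \<in> closure {\<sigma>..<t1}" using t1 by simp
        show "\<bar>x r $ j\<bar> - v $ j * \<zeta> r \<le> 0" if "r \<in> {\<sigma>..<t1}" for r
          using before[of r j] that \<sigma> by auto
      qed
      then show ?thesis using r by simp
    qed (use before that in \<open>auto intro: less_imp_le\<close>)
    define s :: real where "s = (if 0 \<le> x t1 $ i then 1 else -1)"
    have s: "\<bar>s\<bar> = 1" "s * x t1 $ i = \<bar>x t1 $ i\<bar>" by (auto simp: s_def)
    have sx: "s * x r $ i \<le> \<bar>x r $ i\<bar>" for r by (auto simp: s_def)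
    have touch: "s * x t1 $ i = v $ i * \<zeta> t1" using s i upto[of t1 i] t1 \<sigma> by auto
    have upper: "s * x' t1 $ i \<le> - (\<kappa> * p i t1 * z t1)"
    proof (rule key)
      show "\<sigma> \<le> t1" by fact
      show "0 \<le> z t1" by (rule z0)
      show "0 \<le> \<epsilon> * (1 + t1)" using \<epsilon> t1 \<sigma> by simp
      show "\<bar>s\<bar> = 1" by fact
      show "s * x t1 $ i = v $ i * (z t1 + \<epsilon> * (1 + t1))" using touch by (simp add: \<zeta>_def)
      show "\<bar>x t1 $ j\<bar> \<le> v $ j * (z t1 + \<epsilon> * (1 + t1))" for j
        using upto[of t1 j] t1 \<sigma> by (simp add: \<zeta>_def)
      fix r j assume r: "t1 - \<delta> t1 \<le> r" "r \<le> t1"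
      have r0: "0 \<le> r" using r delay[OF i(1)] by linarith
      have "z r = z t1 * exp (c * (E t1 - E r))"
        by (simp add: z_def algebra_simps flip: exp_add)
      also have "\<dots> \<le> z t1 * \<beta>"
      proof (rule mult_left_mono[OF _ z0])
        have "exp (c * (E t1 - E r)) \<le> exp (c * B)" using E_delay[OF i(1) r] c by simp
        with \<beta> show "exp (c * (E t1 - E r)) \<le> \<beta>" by linarith
      qed
      finally have "\<zeta> r \<le> \<beta> * z t1 + \<epsilon> * (1 + t1)" using r \<epsilon> by (simp add: \<zeta>_def mult.commute add_mono)
      then have "v $ j * \<zeta> r \<le> v $ j * (\<beta> * z t1 + \<epsilon> * (1 + t1))"
        using v[of j] by (intro mult_left_mono) auto
      with upto[OF r0 r(2), of j] show "\<bar>x r $ j\<bar> \<le> v $ j * (\<beta> * z t1 + \<epsilon> * (1 + t1))" by linarith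
    qed
    \<comment> \<open>Replacing \<open>E\<close> by \<open>Q\<close> in the exponent gives the differentiable function above the majorant.\<close>
    define Q where "Q = (\<lambda>r. integral {\<sigma>..r} (p i))"
    have p_int: "continuous_on {a..b} (p i)" if "\<sigma> \<le> a" for a b
      by (rule continuous_on_subset[OF p_cont]) (use that \<sigma> in auto)
    have Qd: "(Q has_real_derivative p i t1) (at t1 within {\<sigma>..t1})"
      unfolding Q_def using t1 by (intro integral_has_real_derivative p_int) auto
    have xd: "((\<lambda>u. x u $ i) has_real_derivative x' t1 $ i) (at t1 within {\<sigma>..t1})"
      by (rule DERIV_subset[OF x_deriv[OF i(1)]]) auto
    have "0 \<le> s * x' t1 $ i - v $ i * (z t1 * (c * - p i t1) + \<epsilon>)"
    proof (rule derivative_nonneg_at_right_end_maximum[OF t1])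
      show "((\<lambda>r. s * x r $ i - v $ i * (z t1 * exp (c * (Q t1 - Q r)) + \<epsilon> * (1 + r))) has_real_derivative
        s * x' t1 $ i - v $ i * (z t1 * (c * - p i t1) + \<epsilon>)) (at t1 within {\<sigma>..t1})"
        by (auto intro!: derivative_eq_intros xd Qd)
      fix r assume r: "r \<in> {\<sigma>..t1}"
      have "Q r + integral {r..t1} (p i) = Q t1" unfolding Q_def
        using r by (intro Henstock_Kurzweil_Integration.integral_combine integrable_continuous_real p_int) auto
      then have "E t1 - E r \<le> Q t1 - Q r" using E_incr[of r t1 i] r by auto
      then have "z t1 * exp (c * (E t1 - E r)) \<le> z t1 * exp (c * (Q t1 - Q r))"
        using c by (intro mult_left_mono z0) simp
      moreover have "z r = z t1 * exp (c * (E t1 - E r))"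
        by (simp add: z_def algebra_simps flip: exp_add)
      ultimately have "\<zeta> r \<le> z t1 * exp (c * (Q t1 - Q r)) + \<epsilon> * (1 + r)" by (simp add: \<zeta>_def)
      then have "v $ i * \<zeta> r \<le> v $ i * (z t1 * exp (c * (Q t1 - Q r)) + \<epsilon> * (1 + r))"
        using v[of i] by (intro mult_left_mono) auto
      moreover have "s * x r $ i \<le> v $ i * \<zeta> r" using sx[of r] upto[of r i] r \<sigma> by auto
      ultimately show "s * x r $ i - v $ i * (z t1 * exp (c * (Q t1 - Q r)) + \<epsilon> * (1 + r)) \<le>
        s * x t1 $ i - v $ i * (z t1 * exp (c * (Q t1 - Q t1)) + \<epsilon> * (1 + t1))"
        using touch by (simp add: \<zeta>_def)
    qed
    moreover have "c * v $ i * (p i t1 * z t1) \<le> \<kappa> * (p i t1 * z t1)"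
      by (intro mult_right_mono \<kappa> mult_nonneg_nonneg p_nonneg i(1) z0)
    moreover have "0 < v $ i * \<epsilon>" using v[of i] \<epsilon> by simp
    ultimately show False using upper by (simp add: algebra_simps)
  qed
  show ?thesis
  proof (rule field_le_epsilon)
    fix \<eta> :: real assume \<eta>: "0 < \<eta>"
    have "v $ j \<noteq> 0" "1 + t \<noteq> 0" using v[of j] t by auto
    then have "v $ j * (\<eta> / (v $ j * (1 + t)) * (1 + t)) = \<eta>" by simp
    moreover have "0 < \<eta> / (v $ j * (1 + t))"
      using \<eta> v[of j] t by (intro divide_pos_pos mult_pos_pos) auto
    ultimately show "\<bar>x t $ j\<bar> \<le> v $ j * (W * exp (- c * E t)) + \<eta>"
      using strict[of "\<eta> / (v $ j * (1 + t))" t j] t unfolding distrib_left[of "v $ j"] by linarith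
  qed
qed

lemma nonneg_matrix_times_positive_vector:
  fixes A :: "real^'n^'m"
  assumes "\<And>j. 0 \<le> A $ i $ j" and "\<And>j. 0 < v $ j"
  shows "0 \<le> (A *v v) $ i"
  using assms by (simp add: matrix_vector_mult_def sum_nonneg less_imp_le)

text \<open>
  The matrix conditions at one instant.  If row \<open>i\<close> attains the bound \<open>v\<^sub>i (Z + Y)\<close>, then with
  \<open>p = (D_hat D v)\<^sub>i\<close> and \<open>a = (A v)\<^sub>i\<close> the right-hand side, in the direction of the sign of \<open>y\<^sub>i\<close>, is at
  most \<open>- p (Z + Y) + a (\<beta> Z + Y)\<close>, and \<open>\<alpha> a \<le> p\<close> turns this into \<open>- (1 - \<beta> / \<alpha>) p Z\<close>: the slack
  \<open>\<alpha> > 1\<close> absorbs the factor \<open>\<beta>\<close> by which the delayed decaying part exceeds the current one.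
\<close>

lemma delayed_row_inequality:
  fixes D A :: "real^'n^'n" and v y z :: "real^'n"
  assumes A: "\<And>i j. 0 \<le> A $ i $ j" and v: "\<And>i. 0 < v $ i" and \<alpha>: "1 < \<alpha>" and \<beta>: "0 \<le> \<beta>"
    and dom: "\<alpha> *\<^sub>R (A *v v) \<le> D_hat D *v v"
    and Z: "0 \<le> Z" "0 \<le> Y" and s: "\<bar>s\<bar> = 1" "s * y $ i = v $ i * (Z + Y)"
    and y: "\<And>j. \<bar>y $ j\<bar> \<le> v $ j * (Z + Y)"
    and l: "\<And>j. \<bar>l j\<bar> \<le> A $ i $ j * (v $ j * (\<beta> * Z + Y))"
  shows "s * (- (\<Sum>j\<in>UNIV. D $ i $ j * y $ j) + (\<Sum>j\<in>UNIV. l j)) \<le> - ((1 - \<beta> / \<alpha>) * (D_hat D *v v) $ i * Z)"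
proof -
  let ?d = "(D_hat D *v v) $ i" and ?a = "(A *v v) $ i"
  have d: "s * (- (D $ i $ j * y $ j)) \<le> - (D_hat D $ i $ j * v $ j * (Z + Y))" for j
  proof (cases "j = i")
    case True
    have "s * (- (D $ i $ i * y $ i)) = - (D $ i $ i * (s * y $ i))" by simp
    also have "\<dots> = - (D_hat D $ i $ i * v $ i * (Z + Y))" by (simp only: s(2)) (simp add: D_hat_def)
    finally show ?thesis using True by simp
  next
    case False
    have "s * (- (D $ i $ j * y $ j)) \<le> \<bar>s * (- (D $ i $ j * y $ j))\<bar>" by simp
    also have "\<dots> = \<bar>D $ i $ j\<bar> * \<bar>y $ j\<bar>" using s(1) by (simp add: abs_mult)
    also have "\<dots> \<le> \<bar>D $ i $ j\<bar> * (v $ j * (Z + Y))" by (intro mult_left_mono y) simp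
    finally show ?thesis using False by (simp add: D_hat_def mult.assoc)
  qed
  have ll: "s * l j \<le> A $ i $ j * v $ j * (\<beta> * Z + Y)" for j
  proof -
    have "s * l j \<le> \<bar>s * l j\<bar>" by simp
    also have "\<dots> = \<bar>l j\<bar>" using s(1) by (simp add: abs_mult)
    finally show ?thesis using l[of j] by (simp add: mult.assoc)
  qed
  have "s * (- (\<Sum>j\<in>UNIV. D $ i $ j * y $ j) + (\<Sum>j\<in>UNIV. l j)) =
      (\<Sum>j\<in>UNIV. s * (- (D $ i $ j * y $ j))) + (\<Sum>j\<in>UNIV. s * l j)"
    by (simp add: right_diff_distrib sum_distrib_left sum_negf)
  also have "\<dots> \<le> (\<Sum>j\<in>UNIV. - (D_hat D $ i $ j * v $ j * (Z + Y))) + (\<Sum>j\<in>UNIV. A $ i $ j * v $ j * (\<beta> * Z + Y))"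
    by (intro add_mono sum_mono d ll)
  also have "\<dots> = - (?d * (Z + Y)) + ?a * (\<beta> * Z + Y)"
    by (simp add: matrix_vector_mult_def sum_negf sum_distrib_right)
  also have "\<dots> \<le> - ((1 - \<beta> / \<alpha>) * ?d * Z)"
  proof -
    have a0: "0 \<le> ?a" by (rule nonneg_matrix_times_positive_vector[OF A v])
    have ad: "\<alpha> * ?a \<le> ?d" using dom by (simp add: less_eq_vec_def)
    then have a1: "?a \<le> ?d / \<alpha>" using \<alpha> by (simp add: field_simps)
    have "1 * ?a \<le> \<alpha> * ?a" by (rule mult_right_mono) (use \<alpha> a0 in auto)
    then have "?a * Y \<le> ?d * Y" using ad Z by (intro mult_right_mono) auto
    moreover have "?a * (\<beta> * Z) \<le> ?d / \<alpha> * (\<beta> * Z)"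
      using a1 \<beta> Z by (intro mult_right_mono) auto
    ultimately show ?thesis by (simp add: algebra_simps)
  qed
  finally show ?thesis .
qed

text \<open>
  The assumptions on \<open>e\<close> are in terms of the Lebesgue integral, while the comparison uses the
  Henstock--Kurzweil integral; the facts below pass from one to the other.
\<close>

lemma locally_integrable:
  fixes e :: "real \<Rightarrow> real"
  assumes int: "\<And>K. compact K \<Longrightarrow> set_integrable lebesgue K e"
  shows cumulative_integral_integrable: "\<And>a b. e integrable_on {a..b}"
    and cumulative_integral_lebesgue: "\<And>a b. (LINT t:{a..b}|lebesgue. e t) = integral {a..b} e"
    and cumulative_integral_diff: "\<And>r t. 0 \<le> r \<Longrightarrow> r \<le> t \<Longrightarrow>
      integral {0..t} e - integral {0..r} e = integral {r..t} e"
    and cumulative_integral_continuous: "continuous_on {0..} (\<lambda>t. integral {0..t} e)"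
proof -
  show i: "e integrable_on {a..b}" for a b
    by (rule set_lebesgue_integral_eq_integral(1)[OF int]) simp
  show "(LINT t:{a..b}|lebesgue. e t) = integral {a..b} e" for a b
    by (rule set_lebesgue_integral_eq_integral(2)[OF int]) simp
  show "integral {0..t} e - integral {0..r} e = integral {r..t} e" if "0 \<le> r" "r \<le> t" for r t
    using Henstock_Kurzweil_Integration.integral_combine[OF that i] by simp
  show "continuous_on {0..} (\<lambda>t. integral {0..t} e)"
    by (intro continuous_on_atLeastI indefinite_integral_continuous_1 i)
qed

lemma cumulative_integral_at_top:
  fixes e :: "real \<Rightarrow> real"
  assumes e: "\<And>t. 0 \<le> e t" and int: "\<And>K. compact K \<Longrightarrow> set_integrable lebesgue K e"
    and m: "e \<in> borel_measurable lebesgue"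
    and inf: "(\<integral>\<^sup>+ t\<in>{0..}. ennreal (e t) \<partial>lebesgue) = \<infinity>"
  shows "filterlim (\<lambda>t. integral {0..t} e) at_top at_top"
proof -
  let ?E = "\<lambda>t. integral {0..t} e"
  note i = cumulative_integral_integrable[OF int] and l = cumulative_integral_lebesgue[OF int]
  have mono: "?E r \<le> ?E t" if "0 \<le> r" "r \<le> t" for r t
    using that e by (intro integral_subset_le i) auto
  have nn: "(\<integral>\<^sup>+ t. ennreal (e t) * indicator {0..real n} t \<partial>lebesgue) = ennreal (?E (real n))" for n
  proof -
    have "(\<integral>\<^sup>+ t. ennreal (e t) * indicator {0..real n} t \<partial>lebesgue) =
        (\<integral>\<^sup>+ t. ennreal (indicator {0..real n} t *\<^sub>R e t) \<partial>lebesgue)"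
      by (intro nn_integral_cong) (auto simp: indicator_def)
    also have "\<dots> = ennreal (LINT t|lebesgue. indicator {0..real n} t *\<^sub>R e t)"
      using int[of "{0..real n}"] e
      by (intro nn_integral_eq_integral) (auto simp: set_integrable_def)
    finally show ?thesis using l[of 0 "real n"] by (simp add: set_lebesgue_integral_def)
  qed
  have unbounded: "\<exists>n. B < ?E (real n)" for B
  proof (rule ccontr)
    assume "\<not> ?thesis"
    then have B: "?E (real n) \<le> B" for n by (simp add: not_less)
    have "(\<integral>\<^sup>+ t\<in>{0..}. ennreal (e t) \<partial>lebesgue) =
        (\<integral>\<^sup>+ t. (SUP n. ennreal (e t) * indicator {0..real n} t) \<partial>lebesgue)"
    proof (rule nn_integral_cong)
      fix t
      show "ennreal (e t) * indicator {0..} t = (SUP n. ennreal (e t) * indicator {0..real n} t)"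
      proof (rule antisym)
        obtain n where "t \<le> real n" using real_arch_simple by blast
        then show "ennreal (e t) * indicator {0..} t \<le> (SUP n. ennreal (e t) * indicator {0..real n} t)"
          by (intro SUP_upper2[of n]) (auto simp: indicator_def)
        show "(SUP n. ennreal (e t) * indicator {0..real n} t) \<le> ennreal (e t) * indicator {0..} t"
          by (rule SUP_least) (auto simp: indicator_def)
      qed
    qed
    also have "\<dots> = (SUP n. \<integral>\<^sup>+ t. ennreal (e t) * indicator {0..real n} t \<partial>lebesgue)"
    proof (rule nn_integral_monotone_convergence_SUP)
      show "incseq (\<lambda>n t. ennreal (e t) * indicator {0..real n} t)"
        by (auto simp: incseq_def le_fun_def indicator_def)
      show "(\<lambda>t. ennreal (e t) * indicator {0..real n} t) \<in> borel_measurable lebesgue" for n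
        using m by (intro borel_measurable_times_ennreal measurable_compose[OF m] borel_measurable_indicator) auto
    qed
    also have "\<dots> \<le> ennreal B"
      unfolding nn by (intro SUP_least ennreal_leI B)
    finally show False using inf by (simp add: top_unique)
  qed
  show ?thesis unfolding filterlim_at_top
  proof
    fix B
    obtain n where n: "B < ?E (real n)" using unbounded by blast
    show "eventually (\<lambda>t. B \<le> ?E t) at_top"
      using eventually_ge_at_top[of "real n"]
    proof eventually_elim
      case (elim t)
      then show ?case using mono[of "real n" t] n by simp
    qed
  qed
qed

section \<open>Asymptotic stability\<close>

text \<open>
  A delay term is at most \<open>a\<^sub>i\<^sub>j\<close> times the supremum of its argument over the delay interval; this is
  where the special form of the functionals enters.
\<close>

lemma abs_delay_functional_le:
  assumes "phase_weight g" and "0 \<le> \<tau> i j t" and "0 \<le> A t $ i $ j"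
    and "bounded_variation (\<nu> i j t) (- \<tau> i j t) 0"
    and "(LINT s:{- \<tau> i j t..0}|
       total_variation_measure (stieltjes_signed_measure (\<nu> i j t) (- \<tau> i j t) 0). g s) = 1"
    and "continuous_on {- \<tau> i j t..0} \<psi>" and "\<And>s. s \<in> {- \<tau> i j t..0} \<Longrightarrow> \<bar>\<psi> s\<bar> \<le> K"
  shows "\<bar>delay_functional A \<tau> \<nu> i j t \<psi>\<bar> \<le> A t $ i $ j * K"
proof -
  have "\<bar>stieltjes_integral (\<nu> i j t) (- \<tau> i j t) 0 \<psi>\<bar> \<le> K"
    using assms by (intro abs_stieltjes_integral_le[where g=g] weight_ge_1) auto
  then show ?thesis using assms(3) by (simp add: delay_functional_def abs_mult mult_left_mono)
qed

lemma le_max_delay: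
  fixes \<tau> :: "'n::finite \<Rightarrow> 'n \<Rightarrow> real \<Rightarrow> real"
  shows "\<tau> i j t \<le> max_delay \<tau> t"
proof -
  have "{\<tau> i j t | i j. True} = (\<lambda>(i, j). \<tau> i j t) ` UNIV" by auto
  then have "finite {\<tau> i j t | i j. True}" by simp
  then show ?thesis unfolding max_delay_def by (rule Max_ge) auto
qed

lemma (in linear_delay_system) solution_properties:
  assumes L: "L = delay_functional A \<tau> \<nu>" and \<phi>: "\<phi> \<in> Cg0 g" and \<sigma>: "0 \<le> \<sigma>"
  shows solution_extends: "extends \<sigma> \<phi> (solution D A \<tau> \<nu> \<sigma> \<phi>)"
    and solution_derivative: "\<And>t i. \<sigma> \<le> t \<Longrightarrow>
      ((\<lambda>u. solution D A \<tau> \<nu> \<sigma> \<phi> u $ i) has_real_derivative rhs i t (solution D A \<tau> \<nu> \<sigma> \<phi>)) (at t within {\<sigma>..})"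
proof -
  let ?P = "\<lambda>x. (\<forall>s\<le>0. x (\<sigma> + s) = \<phi> s) \<and>
    (\<forall>t\<ge>\<sigma>. \<forall>i. ((\<lambda>u. x u $ i) has_real_derivative rhs i t x) (at t within {\<sigma>..}))"
  have "is_solution D A \<tau> \<nu> \<sigma> \<phi> = ?P"
    unfolding is_solution_def history_def rhs_def unfolding L by (rule refl)
  then have "?P (solution D A \<tau> \<nu> \<sigma> \<phi>)"
    unfolding solution_def using theI'[OF unique_solution[OF \<phi> \<sigma>]] by simp
  then have h: "\<And>s. s \<le> 0 \<Longrightarrow> solution D A \<tau> \<nu> \<sigma> \<phi> (\<sigma> + s) = \<phi> s"
    and d: "\<And>t i. \<sigma> \<le> t \<Longrightarrow>
      ((\<lambda>u. solution D A \<tau> \<nu> \<sigma> \<phi> u $ i) has_real_derivative rhs i t (solution D A \<tau> \<nu> \<sigma> \<phi>)) (at t within {\<sigma>..})"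
    by blast+
  from d show "\<And>t i. \<sigma> \<le> t \<Longrightarrow>
      ((\<lambda>u. solution D A \<tau> \<nu> \<sigma> \<phi> u $ i) has_real_derivative rhs i t (solution D A \<tau> \<nu> \<sigma> \<phi>)) (at t within {\<sigma>..})" .
  show "extends \<sigma> \<phi> (solution D A \<tau> \<nu> \<sigma> \<phi>)" by (rule solution_fixed_point(1)[OF \<phi> \<sigma> h d])
qed

theorem theorem3p4:
  fixes g :: "real \<Rightarrow> real"
    and D A :: "real \<Rightarrow> real^'n^'n"
    and \<tau> :: "'n \<Rightarrow> 'n \<Rightarrow> real \<Rightarrow> real"
    and \<nu> :: "'n \<Rightarrow> 'n \<Rightarrow> real \<Rightarrow> real \<Rightarrow> real"
    and v :: "real^'n" and \<alpha> T :: real and e :: "real \<Rightarrow> real"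
  assumes "phase_weight g"
    and "\<And>i j. continuous_on {0..} (\<tau> i j)"
    and "\<And>i j t. 0 \<le> t \<Longrightarrow> 0 \<le> \<tau> i j t"
    and "eventually (\<lambda>t. max_delay \<tau> t \<le> t) at_top"
    and "\<And>i j. continuous_on {0..} (\<lambda>t. D t $ i $ j)"
    and "\<And>i j t. 0 \<le> t \<Longrightarrow> 0 \<le> A t $ i $ j"
    and "\<And>i j t. 0 \<le> t \<Longrightarrow> bounded_variation (\<nu> i j t) (- \<tau> i j t) 0"
    and "\<And>i j t. 0 \<le> t \<Longrightarrow>
           (LINT s:{- \<tau> i j t..0}|
              total_variation_measure (stieltjes_signed_measure (\<nu> i j t) (- \<tau> i j t) 0). g s) = 1"
    and "\<And>i j t. 0 \<le> t \<Longrightarrow> delay_functional A \<tau> \<nu> i j t \<in> Cg0_dual g"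
    and "\<And>i j. dual_continuous_on g {0..} (delay_functional A \<tau> \<nu> i j)"
    and "\<And>i. 0 < v $ i" and "1 < \<alpha>" and "0 \<le> T"
    and "\<And>t. T \<le> t \<Longrightarrow> \<alpha> *\<^sub>R (A t *v v) \<le> D_hat (D t) *v v"
    and "e \<in> borel_measurable lebesgue"
    and "\<And>t. 0 \<le> e t"
    and "\<And>K. compact K \<Longrightarrow> set_integrable lebesgue K e"
    and "\<And>t. T \<le> t \<Longrightarrow> e t \<le> Min (range (\<lambda>i. ((D_hat (D t) - A t) *v v) $ i))"
    and "(\<integral>\<^sup>+ t\<in>{0..}. ennreal (e t) \<partial>lebesgue) = \<infinity>"
    and "bdd_above ((\<lambda>t. LINT u:{t - max_delay \<tau> t..t}|lebesgue. e u) ` {T..})"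
  shows "asymptotically_stable g (solution D A \<tau> \<nu>)"
proof -
  note w = assms(1) and v = assms(11) and \<alpha> = assms(12)
  note e = assms(16,17)
  interpret S: linear_delay_system g D "delay_functional A \<tau> \<nu>"
    by standard (use assms in auto)
  define E where "E = (\<lambda>t. integral {0..t} e)"
  define p where "p = (\<lambda>i t. (D_hat (D t) *v v) $ i)"
  \<comment> \<open>Any \<open>\<beta>\<close> strictly between 1 and \<open>\<alpha>\<close> would do.\<close>
  define \<beta> where "\<beta> = (1 + \<alpha>) / 2"
  define \<kappa> where "\<kappa> = 1 - \<beta> / \<alpha>"
  have \<beta>: "1 < \<beta>" and \<kappa>: "0 < \<kappa>" using \<alpha> by (auto simp: \<beta>_def \<kappa>_def field_simps)
  obtain T0' where T0': "\<And>t. T0' \<le> t \<Longrightarrow> max_delay \<tau> t \<le> t"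
    using assms(4) by (auto simp: eventually_at_top_linorder)
  define T0 where "T0 = max T T0'"
  have T0: "0 \<le> T0" "T \<le> T0" "\<And>t. T0 \<le> t \<Longrightarrow> max_delay \<tau> t \<le> t"
    using assms(13) T0' by (auto simp: T0_def)
  obtain B' where B': "\<And>t. T \<le> t \<Longrightarrow> (LINT u:{t - max_delay \<tau> t..t}|lebesgue. e u) \<le> B'"
    using assms(20) by (auto simp: bdd_above_def)
  define B where "B = max B' 0"
  define V where "V = (\<Sum>j\<in>UNIV. v $ j)"
  have vV: "v $ i \<le> V" for i unfolding V_def
    by (rule member_le_sum) (use v in \<open>auto intro: less_imp_le\<close>)
  have V: "0 < V" using vV[of undefined] v[of undefined] by linarith
  \<comment> \<open>The rate is small enough for \<open>exp (c B) \<le> \<beta>\<close> and \<open>c v\<^sub>i \<le> \<kappa>\<close>.\<close>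
  define c where "c = min (ln \<beta> / (B + 1)) (\<kappa> / V)"
  have B1: "0 < B + 1" by (simp add: B_def)
  have c: "0 < c" using \<beta> \<kappa> V B1 by (simp add: c_def)
  have cB: "exp (c * B) \<le> \<beta>"
  proof -
    have "c * B \<le> c * (B + 1)" using c by simp
    also have "\<dots> \<le> ln \<beta> / (B + 1) * (B + 1)" using B1 by (intro mult_right_mono) (auto simp: c_def)
    also have "\<dots> = ln \<beta>" using B1 by simp
    finally have "exp (c * B) \<le> exp (ln \<beta>)" by simp
    then show ?thesis using \<beta> by simp
  qed
  have c\<kappa>: "c * v $ i \<le> \<kappa>" for i
  proof -
    have "c * v $ i \<le> c * V" using c vV by (intro mult_left_mono) auto
    also have "\<dots> \<le> \<kappa> / V * V" using V by (intro mult_right_mono) (auto simp: c_def)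
    finally show ?thesis using V by simp
  qed
  have p_cont: "continuous_on {0..} (p i)" for i
  proof -
    have "continuous_on {0..} (\<lambda>t. D_hat (D t) $ i $ j)" for j
      by (cases "i = j") (auto simp: D_hat_def intro!: continuous_intros assms(5))
    then show ?thesis unfolding p_def matrix_vector_mult_def vec_lambda_beta
      by (intro continuous_on_sum continuous_on_mult continuous_on_const)
  qed
  have e_le_p: "e t \<le> p i t" if "T \<le> t" for i t
  proof -
    have "e t \<le> ((D_hat (D t) - A t) *v v) $ i"
      using assms(18)[OF that] by (rule order_trans) (intro Min_le, auto)
    moreover have "0 \<le> (A t *v v) $ i"
      using assms(6,13) that v by (intro nonneg_matrix_times_positive_vector) auto
    ultimately show ?thesis by (simp add: p_def matrix_vector_mult_diff_rdistrib)
  qed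
  have E_cont: "continuous_on {0..} E" unfolding E_def by (rule cumulative_integral_continuous[OF e(2)])
  have E_mono: "E r \<le> E t" if "0 \<le> r" "r \<le> t" for r t
    unfolding E_def using that e(1)
    by (intro integral_subset_le cumulative_integral_integrable[OF e(2)]) auto
  have E_top: "filterlim E at_top at_top"
    unfolding E_def by (rule cumulative_integral_at_top[OF e assms(15,19)])
  have decay: "\<bar>x t $ j\<bar> \<le> v $ j * (W * exp (- c * E t))"
    if x: "continuous_on UNIV x"
      and d: "\<And>t i. \<sigma> \<le> t \<Longrightarrow> ((\<lambda>u. x u $ i) has_real_derivative S.rhs i t x) (at t within {\<sigma>..})"
      and \<sigma>: "T0 \<le> \<sigma>" and W: "0 \<le> W"
      and init: "\<And>r j. 0 \<le> r \<Longrightarrow> r \<le> \<sigma> \<Longrightarrow> \<bar>x r $ j\<bar> \<le> v $ j * (W * exp (- c * E r))"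
      and t: "0 \<le> t" for x \<sigma> W t j
  proof (rule delay_comparison[where x=x and t=t and E=E and W=W and c=c and x'="\<lambda>t. \<chi> i. S.rhs i t x" and p=p and \<delta>="max_delay \<tau>"
        and \<beta>=\<beta> and \<kappa>=\<kappa> and \<sigma>=\<sigma> and B=B])
    show "0 \<le> \<sigma>" using \<sigma> T0 by simp
    show "continuous_on {0..} (\<lambda>t. x t $ i)" for i
      by (rule continuous_on_subset[of UNIV]) (use x in \<open>auto intro: continuous_intros\<close>)
    show "((\<lambda>u. x u $ i) has_real_derivative (\<chi> i. S.rhs i t x) $ i) (at t within {\<sigma>..})"
      if "\<sigma> \<le> t" for t i using d[OF that] by simp
    show "0 \<le> p i t" if "\<sigma> \<le> t" for t i
      using e_le_p[of t i] e(1)[of t] that \<sigma> T0 by linarith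
    show "E t - E r \<le> integral {r..t} (p i)" if "\<sigma> \<le> r" "r \<le> t" for r t i
    proof -
      have "E t - E r = integral {r..t} e"
        unfolding E_def using that \<sigma> T0 by (intro cumulative_integral_diff[OF e(2)]) auto
      also have "\<dots> \<le> integral {r..t} (p i)"
        using that \<sigma> T0
        by (intro integral_le cumulative_integral_integrable[OF e(2)] integrable_continuous_real
            continuous_on_subset[OF p_cont] e_le_p) auto
      finally show ?thesis .
    qed
    show "max_delay \<tau> t \<le> t" if "\<sigma> \<le> t" for t using that \<sigma> T0 by auto
    show "E t - E r \<le> B" if "\<sigma> \<le> t" "t - max_delay \<tau> t \<le> r" "r \<le> t" for r t
    proof -
      have t0: "0 \<le> t" using that \<sigma> T0 by simp
      have le: "max_delay \<tau> t \<le> t" using that \<sigma> T0 by auto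
      have le_max: "0 \<le> max_delay \<tau> t" 
        using assms(3)[OF t0] le_max_delay[of \<tau> _ _ t] by (rule order_trans)
      have "E t - E r \<le> E t - E (t - max_delay \<tau> t)" using E_mono[of "t - max_delay \<tau> t" r] that le by simp
      also have "\<dots> = (LINT u:{t - max_delay \<tau> t..t}|lebesgue. e u)"
        using cumulative_integral_diff[OF e(2), of "t - max_delay \<tau> t" t] le_max
          cumulative_integral_lebesgue[OF e(2), of "t - max_delay \<tau> t" t] le by (simp add: E_def)
      also have "\<dots> \<le> B" using B'[of t] that \<sigma> T0 by (simp add: B_def)
      finally show ?thesis .
    qed
    fix t i s Z Y
    assume t: "\<sigma> \<le> t" and ZY: "0 \<le> Z" "0 \<le> Y" and s: "\<bar>s\<bar> = 1" "s * x t $ i = v $ i * (Z + Y)"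
      and xt: "\<And>j. \<bar>x t $ j\<bar> \<le> v $ j * (Z + Y)"
      and xr: "\<And>r j. t - max_delay \<tau> t \<le> r \<Longrightarrow> r \<le> t \<Longrightarrow> \<bar>x r $ j\<bar> \<le> v $ j * (\<beta> * Z + Y)"
    have t0: "0 \<le> t" "T \<le> t" using t \<sigma> T0 by auto
    have "s * S.rhs i t x \<le> - ((1 - \<beta> / \<alpha>) * (D_hat (D t) *v v) $ i * Z)"
      unfolding S.rhs_def
    proof (rule delayed_row_inequality[OF assms(6)[OF t0(1)] v \<alpha> _ assms(14)[OF t0(2)] ZY s xt])
      show "0 \<le> \<beta>" using \<beta> by simp
      show "\<bar>delay_functional A \<tau> \<nu> i j t (\<lambda>s. x (t + s) $ j)\<bar> \<le> A t $ i $ j * (v $ j * (\<beta> * Z + Y))" for j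
      proof (rule abs_delay_functional_le[where \<tau>=\<tau> and \<nu>=\<nu> and A=A and i=i and j=j and t=t, OF w assms(3,6,7,8)[OF t0(1)]])
        show "continuous_on {- \<tau> i j t..0} (\<lambda>s. x (t + s) $ j)"
          by (intro continuous_intros continuous_on_compose2[OF x]) auto
        fix s assume s: "s \<in> {- \<tau> i j t..0}"
        have "t - max_delay \<tau> t \<le> t + s" using s le_max_delay[of \<tau> i j t] by auto
        then show "\<bar>x (t + s) $ j\<bar> \<le> v $ j * (\<beta> * Z + Y)" using s by (intro xr) auto
      qed
    qed
    then show "s * (\<chi> i. S.rhs i t x) $ i \<le> - (\<kappa> * p i t * Z)" by (simp add: \<kappa>_def p_def)
  qed (use v W c p_cont E_cont cB c\<kappa> init t in auto)
  note ext = S.solution_extends[OF refl] and der = S.solution_derivative[OF refl]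
  have "stable_from g (solution D A \<tau> \<nu>) T0" unfolding stable_from_def
  proof (intro allI impI)
    fix \<epsilon> \<sigma> :: real assume \<epsilon>: "0 < \<epsilon>" and \<sigma>: "T0 \<le> \<sigma>"
    have \<sigma>0: "0 \<le> \<sigma>" using \<sigma> T0 by simp
    define m where "m = Min (range (\<lambda>j. v $ j))"
    have m: "0 < m" "m \<le> v $ j" for j using v by (auto simp: m_def)
    \<comment> \<open>\<open>\<delta> W1\<close> is the least \<open>W\<close> for which the size \<open>\<delta> g (- \<sigma>)\<close> of the history on \<open>[0, \<sigma>]\<close> lies below \<open>m W exp (- c E \<sigma>)\<close>.\<close>
    define W1 where "W1 = g (- \<sigma>) * exp (c * E \<sigma>) / m"
    have g1: "1 \<le> g (- \<sigma>)" using weight_ge_1[OF w] \<sigma>0 by simp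
    have W1: "0 < W1" using g1 m(1) by (simp add: W1_def)
    define d where "d = 1 + V * W1"
    have den: "0 < d" using V W1 by (simp add: d_def add_pos_pos)
    define \<delta> where "\<delta> = \<epsilon> / 2 / d"
    have \<delta>: "0 < \<delta>" using \<epsilon> den by (simp add: \<delta>_def)
    have \<delta>\<epsilon>: "\<delta> \<le> \<epsilon> / 2" "V * (\<delta> * W1) \<le> \<epsilon> / 2"
    proof -
      have eq: "\<delta> + V * (\<delta> * W1) = \<epsilon> / 2"
      proof -
        have "\<delta> + V * (\<delta> * W1) = \<delta> * d" by (simp add: d_def algebra_simps)
        also have "\<dots> = \<epsilon> / 2" using den by (simp add: \<delta>_def)
        finally show ?thesis .
      qed
      moreover have "0 \<le> V * (\<delta> * W1)" using V \<delta> W1 by simp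
      ultimately show "\<delta> \<le> \<epsilon> / 2" "V * (\<delta> * W1) \<le> \<epsilon> / 2" using \<delta> by linarith+
    qed
    have "Cg0_norm g (history (solution D A \<tau> \<nu> \<sigma> \<phi>) t) < \<epsilon>"
      if \<phi>: "\<phi> \<in> Cg0 g" "Cg0_norm g \<phi> < \<delta>" and t: "\<sigma> \<le> t" for \<phi> t
    proof -
      let ?x = "solution D A \<tau> \<nu> \<sigma> \<phi>"
      have past: "\<bar>?x r $ j\<bar> \<le> \<delta> * g (r - \<sigma>)" if "r \<le> \<sigma>" for r j
      proof -
        have "?x r = \<phi> (r - \<sigma>)" by (rule S.extends_past[OF ext[OF \<phi>(1) \<sigma>0] that])
        then have "\<bar>?x r $ j\<bar> \<le> infnorm (\<phi> (r - \<sigma>))" using component_le_infnorm_cart[of "?x r" j] by simp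
        also have "\<dots> \<le> Cg0_norm g \<phi> * g (r - \<sigma>)" using that by (intro infnorm_le_Cg0_norm[OF w \<phi>(1)]) auto
        also have "\<dots> \<le> \<delta> * g (r - \<sigma>)"
          using \<phi>(2) weight_ge_1[OF w, of "r - \<sigma>"] that by (intro mult_right_mono) auto
        finally show ?thesis .
      qed
      have bound: "\<bar>?x r $ j\<bar> \<le> v $ j * (\<delta> * W1 * exp (- c * E r))" if "0 \<le> r" for r j
      proof (rule decay[OF _ der[OF \<phi>(1) \<sigma>0] \<sigma> _ _ that])
        show "continuous_on UNIV ?x" using ext[OF \<phi>(1) \<sigma>0] by (simp add: S.extends_def)
        show "0 \<le> \<delta> * W1" using \<delta> W1 by simp
        fix r j assume r: "0 \<le> r" "r \<le> \<sigma>"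
        have "g (r - \<sigma>) \<le> g (- \<sigma>)" using r by (intro weight_antimono[OF w]) auto
        then have "\<bar>?x r $ j\<bar> \<le> \<delta> * g (- \<sigma>)"
          using past[OF r(2), of j] \<delta> by (meson mult_le_cancel_left_pos order_trans)
        also have "\<dots> = m * (\<delta> * W1 * exp (- c * E \<sigma>))"
          using m(1) by (simp add: W1_def exp_minus)
        also have "\<dots> \<le> v $ j * (\<delta> * W1 * exp (- c * E r))"
        proof (rule mult_mono[OF m(2)])
          show "\<delta> * W1 * exp (- c * E \<sigma>) \<le> \<delta> * W1 * exp (- c * E r)"
            using \<delta> W1 c E_mono[OF r] by (intro mult_left_mono) auto
        qed (use \<delta> W1 v[of j] in auto)
        finally show "\<bar>?x r $ j\<bar> \<le> v $ j * (\<delta> * W1 * exp (- c * E r))" .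
      qed
      have E0: "0 \<le> E r" if "0 \<le> r" for r using E_mono[of 0 r] that by (simp add: E_def)
      have "Cg0_norm g (history ?x t) \<le> \<epsilon> / 2"
      proof (rule Cg0_norm_le[OF w])
        fix s :: real assume s: "s \<le> 0"
        have "\<bar>?x (t + s) $ j\<bar> \<le> \<epsilon> / 2 * g s" for j
        proof (cases "t + s \<le> \<sigma>")
          case True
          have "\<delta> * g (t + s - \<sigma>) \<le> \<epsilon> / 2 * g s"
            using True t \<delta>\<epsilon>(1) \<epsilon> weight_ge_1[OF w, of "t + s - \<sigma>"]
            by (intro mult_mono weight_antimono[OF w]) auto
          with past[OF True, of j] show ?thesis by linarith
        next
          case False
          then have r: "0 \<le> t + s" using \<sigma>0 by simp
          have "v $ j * (\<delta> * W1 * exp (- c * E (t + s))) \<le> V * (\<delta> * W1 * 1)"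
            using vV[of j] v[of j] V \<delta> W1 c E0[OF r] by (intro mult_mono) auto
          also have "\<dots> \<le> \<epsilon> / 2 * 1" using \<delta>\<epsilon>(2) by simp
          also have "\<dots> \<le> \<epsilon> / 2 * g s" using \<epsilon> weight_ge_1[OF w s] by (intro mult_left_mono) auto
          finally show ?thesis using bound[OF r, of j] by linarith
        qed
        then show "infnorm (history ?x t s) \<le> \<epsilon> / 2 * g s"
          unfolding infnorm_le_iff_component history_def by blast
      qed
      then show ?thesis using \<epsilon> by linarith
    qed
    with \<delta> show "\<exists>\<delta>>0. \<forall>\<phi>\<in>Cg0 g. Cg0_norm g \<phi> < \<delta> \<longrightarrow>
        (\<forall>t\<ge>\<sigma>. Cg0_norm g (history (solution D A \<tau> \<nu> \<sigma> \<phi>) t) < \<epsilon>)" by blast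
  qed
  moreover have "(solution D A \<tau> \<nu> \<sigma> \<phi> \<longlongrightarrow> 0) at_top" if \<sigma>: "0 \<le> \<sigma>" and \<phi>: "\<phi> \<in> Cg0 g" for \<sigma> \<phi>
  proof -
    let ?x = "solution D A \<tau> \<nu> \<sigma> \<phi>"
    \<comment> \<open>Starting the comparison later than \<open>\<sigma>\<close> is harmless: on the compact interval \<open>[0, \<sigma>']\<close> the solution is below some multiple of the majorant.\<close>
    define \<sigma>' where "\<sigma>' = max \<sigma> T0"
    have x: "continuous_on UNIV ?x" using ext[OF \<phi> \<sigma>] by (simp add: S.extends_def)
    define f where "f = (\<lambda>j r. \<bar>?x r $ j\<bar> / (v $ j * exp (- c * E r)))"
    have "bounded (f j ` {0..\<sigma>'})" for j
    proof (intro compact_imp_bounded compact_continuous_image)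
      show "continuous_on {0..\<sigma>'} (f j)" unfolding f_def using v[of j]
        by (intro continuous_intros continuous_on_subset[OF x] continuous_on_subset[OF E_cont]) auto
    qed simp
    then have "\<exists>W. \<forall>r\<in>{0..\<sigma>'}. f j r \<le> W" for j
      unfolding bounded_iff by (metis abs_le_D1 image_eqI real_norm_def)
    then obtain W' where W': "\<And>j r. r \<in> {0..\<sigma>'} \<Longrightarrow> f j r \<le> W' j" by metis
    define W where "W = (\<Sum>j\<in>UNIV. \<bar>W' j\<bar>)"
    have W: "0 \<le> W" by (simp add: W_def sum_nonneg)
    have bound: "\<bar>?x t $ j\<bar> \<le> v $ j * (W * exp (- c * E t))" if "0 \<le> t" for t j
    proof (rule decay[OF x _ _ W _ that])
      show "T0 \<le> \<sigma>'" by (simp add: \<sigma>'_def)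
      show "((\<lambda>u. ?x u $ i) has_real_derivative S.rhs i t ?x) (at t within {\<sigma>'..})" if "\<sigma>' \<le> t" for t i
        by (rule DERIV_subset[OF der[OF \<phi> \<sigma>]]) (use that in \<open>auto simp: \<sigma>'_def\<close>)
      fix r j assume r: "0 \<le> r" "r \<le> \<sigma>'"
      have "f j r \<le> W' j" using W' r by auto
      also have "W' j \<le> \<bar>W' j\<bar>" by simp
      also have "\<dots> \<le> W" unfolding W_def by (rule member_le_sum) auto
      finally have "f j r \<le> W" .
      moreover have "0 < v $ j * exp (- c * E r)" using v[of j] by simp
      ultimately show "\<bar>?x r $ j\<bar> \<le> v $ j * (W * exp (- c * E r))"
        by (simp add: f_def divide_le_eq mult_ac)
    qed
    have exp0: "((\<lambda>t. exp (- c * E t)) \<longlongrightarrow> 0) at_top"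
    proof -
      have "filterlim (\<lambda>t. c * E t) at_top at_top"
        by (rule filterlim_tendsto_pos_mult_at_top[OF tendsto_const c E_top])
      then have "filterlim (\<lambda>t. - (c * E t)) at_bot at_top" by (simp add: filterlim_uminus_at_bot)
      from filterlim_compose[OF exp_at_bot this] show ?thesis by simp
    qed
    have "((\<lambda>t. ?x t $ j) \<longlongrightarrow> 0) at_top" for j
    proof (rule Lim_null_comparison)
      show "eventually (\<lambda>t. norm (?x t $ j) \<le> v $ j * (W * exp (- c * E t))) at_top"
        using eventually_ge_at_top[of 0] by eventually_elim (use bound in auto)
      have "((\<lambda>t. v $ j * (W * exp (- c * E t))) \<longlongrightarrow> v $ j * (W * 0)) at_top"
        by (intro tendsto_mult tendsto_const exp0)
      then show "((\<lambda>t. v $ j * (W * exp (- c * E t))) \<longlongrightarrow> 0) at_top" by simp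
    qed
    then show ?thesis by (intro vec_tendstoI) simp
  qed
  ultimately show ?thesis unfolding asymptotically_stable_def using T0(1) by blast
qed

end
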